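(* Let $G=GL_n(\mathbb{F}_q)$, let $g\in G$ and let $\mathcal{C}_g$ be the conjugacy class of $g$ in $G$. (a) For every $w\in W$, $$\mathrm{Card}(Y^{-1}_{BwB}(g^{-1})) = \mathrm{tr}(gT_w,\mathbf{1}_B^G) = \frac{|G/B|}{|\mathcal{C}_g|}\,\mathrm{Card}(\mathcal{C}_g\cap Bw^{-1}B) = \sum_{\lambda\in\hat H}\chi^\lambda_G(g)\chi^\lambda_H(T_w).$$ (b) The element $$A_g=\sum_{w\in W}\mathrm{tr}(gT_w,\mathbf{1}_B^G)\,q^{-\ell(w)}T_{w^{-1}}$$ of $H$ lies in the center $Z(H)$, satisfies $$A_g=\sum_{\nu\in\mathcal{W}}\mathrm{tr}(gT_{\gamma_\nu},\mathbf{1}_B^G)\,\kappa_\nu = |G/B|\sum_{\lambda\in\hat H}\frac{\chi^\lambda_G(g)}{\chi^\lambda_G(1)}\,z^H_\lambda ,$$ and acts on $\mathbf{1}_B^G$ (by right multiplication) in the same way as the element $\frac{|G/B|}{|\mathcal{C}_g|}C_g$ of $Z(\mathbb{C}G)$ acts (by left multiplication), where $C_g=\sum_{x\in\mathcal{C}_g}x$.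
   Context: $\mathbb{F}_q$ is a finite field with $q$ elements, $G=GL_n(\mathbb{F}_q)$, $B$ is the subgroup of upper triangular matrices, and $W\cong S_n$ is the subgroup of permutation matrices, with simple reflections $s_1,\dots,s_{n-1}$ (adjacent transpositions) and length function $\ell$. The Bruhat decomposition is $G=\bigsqcup_{w\in W}BwB$. Lusztig variety: for $g\in G$, $w\in W$, $Y^{-1}_{BwB}(g)=\{yB\in G/B \mid y^{-1}gy\in BwB\}$. Hecke algebra: $H=\mathbb{C}\text{-span}\{T_w\mid w\in W\}\subseteq\mathbb{C}G$, where $T_w=\frac{1}{|B|}\sum_{x\in BwB}x$. It is an algebra with unit $T_1$ (a nonunital subalgebra of $\mathbb{C}G$). Flag representation: for $g\in G$ let $v_g=\frac1{|B|}\sum_{x\in gB}x$, and $\mathbf{1}_B^G=\mathbb{C}\text{-span}\{v_g\mid g\in G\}\subseteq\mathbb{C}G$, of dimension $|G/B|$. $\mathbb{C}G$ acts on it by left multiplication and $H$ acts by right multiplication. For $g\in G$ and $h\in H$, $\mathrm{tr}(gh,\mathbf{1}_B^G)$ is the trace of the linear map $v\mapsto g\,v\,h$ on $\mathbf{1}_B^G$. $\hat H$ is an index set for the irreducible $H$-modules. As $(G,H)$-bimodules, $\mathbf{1}_B^G\cong\bigoplus_{\lambda\in\hat H}G^\lambda\otimes H^\lambda$, where $H^\lambda$ is the irreducible (right) $H$-module indexed by $\lambda$ and $G^\lambda$ is the corresponding irreducible $G$-module. Characters: $\chi^\lambda_H(T_w)=\mathrm{tr}(T_w,H^\lambda)$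 and $\chi^\lambda_G(g)=\mathrm{tr}(g,G^\lambda)$. $Z(H)$ and $Z(\mathbb{C}G)$ are the centers of $H$ and $\mathbb{C}G$. The minimal central idempotents of $H$ are $$z^H_\lambda=\frac{\chi^\lambda_G(1)}{|G/B|}\sum_{w\in W}\chi^\lambda_H(T_w)q^{-\ell(w)}T_{w^{-1}},\qquad \lambda\in\hat H .$$ $\mathcal{W}$ is an index set for the conjugacy classes $\mathcal{W}_\nu$ of $W$, and $\gamma_\nu$ denotes a minimal length element of $\mathcal{W}_\nu$. The Geck–Rouquier basis $\{\kappa_\nu\mid\nu\in\mathcal{W}\}$ of $Z(H)$ consists of the elements $\kappa_\nu=\sum_{w\in W}\kappa_{\nu,w}q^{-\ell(w)}T_w\in Z(H)$ determined by $\kappa_{\nu,\gamma_\mu}=\delta_{\nu\mu}$ whenever $\gamma_\mu$ is a minimal length element of the conjugacy class $\mathcal{W}_\mu$. *)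

theory Defs
  imports
    "Jordan_Normal_Form.Matrix"
    "HOL-Algebra.Left_Coset"
    "HOL-Combinatorics.Permutations"
    "HOL-Library.Function_Algebras"
    "HOL-Library.Indicator_Function"
    Complex_Main
begin

section \<open>The group, its Borel subgroup and its Weyl group\<close>

definition GL :: "nat \<Rightarrow> 'a::field mat monoid" where
  "GL n = units_of (ring_mat TYPE('a) n ())"

definition borel_subgroup :: "nat \<Rightarrow> 'a::field mat set" where
  "borel_subgroup n = {b \<in> carrier (GL n). upper_triangular b}"

text \<open>The matrix of a permutation acts on the standard basis by \<open>e\<^sub>j \<mapsto> e\<^bsub>p j\<^esub>\<close>.\<close>

definition perm_mat :: "nat \<Rightarrow> (nat \<Rightarrow> nat) \<Rightarrow> 'a::field mat" where
  "perm_mat n p = mat n n (\<lambda>(i, j). if i = p j then 1 else 0)"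

definition weyl_group :: "nat \<Rightarrow> 'a::field mat set" where
  "weyl_group n = perm_mat n ` {p. p permutes {..<n}}"

definition simple_reflections :: "nat \<Rightarrow> 'a::field mat set" where
  "simple_reflections n = {perm_mat n (Transposition.transpose i (Suc i)) | i. Suc i < n}"

definition weyl_length :: "nat \<Rightarrow> 'a::field mat \<Rightarrow> nat" where
  "weyl_length n w =
     (LEAST k. \<exists>ss. length ss = k \<and> set ss \<subseteq> simple_reflections n \<and> foldr (*) ss (1\<^sub>m n) = w)"

definition double_coset :: "nat \<Rightarrow> 'a::field mat \<Rightarrow> 'a mat set" where
  "double_coset n w = {b * w * b' | b b'. b \<in> borel_subgroup n \<and> b' \<in> borel_subgroup n}"

definition conj_class :: "nat \<Rightarrow> 'a::field mat set \<Rightarrow> 'a mat \<Rightarrow> 'a mat set" where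
  "conj_class n K g = {x * g * inv\<^bsub>GL n\<^esub> x | x. x \<in> K}"

abbreviation GL_class :: "nat \<Rightarrow> 'a::field mat \<Rightarrow> 'a mat set" where
  "GL_class n g \<equiv> conj_class n (carrier (GL n)) g"

text \<open>The conjugacy classes of the Weyl group serve as their own index set.\<close>

definition weyl_classes :: "nat \<Rightarrow> 'a::field mat set set" where
  "weyl_classes n = conj_class n (weyl_group n) ` weyl_group n"

definition min_length_elements :: "nat \<Rightarrow> 'a::field mat set \<Rightarrow> 'a mat set" where
  "min_length_elements n \<nu> = {w \<in> \<nu>. \<forall>u\<in>\<nu>. weyl_length n w \<le> weyl_length n u}"

definition flags :: "nat \<Rightarrow> 'a::field mat set set" where
  "flags n = lcosets\<^bsub>GL n\<^esub> (borel_subgroup n)"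

definition lusztig_variety :: "nat \<Rightarrow> 'a::field mat \<Rightarrow> 'a mat \<Rightarrow> 'a mat set set" where
  "lusztig_variety n w g =
     {y <#\<^bsub>GL n\<^esub> borel_subgroup n | y.
        y \<in> carrier (GL n) \<and> inv\<^bsub>GL n\<^esub> y * g * y \<in> double_coset n w}"


section \<open>The group algebra, the Hecke algebra and the flag representation\<close>

text \<open>
  An element \<open>\<Sum>x\<in>G. f x \<cdot> x\<close> of the group algebra is represented by its coefficient function
  \<open>f\<close>, which vanishes outside \<open>G\<close>; thus \<open>indicator S\<close> is the sum of the elements of \<open>S\<close> and
  \<open>indicator {g}\<close> is the group element \<open>g\<close>.  Addition is the pointwise one.  The product is
  convolution \<open>galg_mult\<close>, not the pointwise product \<open>(*)\<close> of functions.
\<close>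

definition cscale :: "complex \<Rightarrow> ('b \<Rightarrow> complex) \<Rightarrow> 'b \<Rightarrow> complex" where
  "cscale c f = (\<lambda>x. c * f x)"

global_interpretation cfun: vector_space "cscale :: complex \<Rightarrow> ('b \<Rightarrow> complex) \<Rightarrow> 'b \<Rightarrow> complex"
  by unfold_locales (auto simp: cscale_def fun_eq_iff algebra_simps)

text \<open>
  Trace of a linear endomorphism \<open>\<phi>\<close> of a finite-dimensional space \<open>V\<close> of functions: the sum of
  the diagonal entries of its matrix in a basis of \<open>V\<close> (the value does not depend on the basis).
\<close>

definition trace_on :: "('b \<Rightarrow> complex) set \<Rightarrow> (('b \<Rightarrow> complex) \<Rightarrow> ('b \<Rightarrow> complex)) \<Rightarrow> complex" where
  "trace_on V \<phi> =
     (let \<B> = (SOME \<B>. cfun.independent \<B> \<and> cfun.span \<B> = V)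
      in \<Sum>b\<in>\<B>. cfun.representation \<B> (\<phi> b) b)"

definition group_algebra :: "nat \<Rightarrow> ('a::{field,finite} mat \<Rightarrow> complex) set" where
  "group_algebra n = {f. \<forall>x. x \<notin> carrier (GL n) \<longrightarrow> f x = 0}"

definition galg_mult ::
  "nat \<Rightarrow> ('a::{field,finite} mat \<Rightarrow> complex) \<Rightarrow> ('a mat \<Rightarrow> complex) \<Rightarrow> 'a mat \<Rightarrow> complex" where
  "galg_mult n f h =
     (\<lambda>x. \<Sum>(y, z) \<in> {(y, z) \<in> carrier (GL n) \<times> carrier (GL n). y * z = x}. f y * h z)"

definition center_of :: "nat \<Rightarrow> ('a::{field,finite} mat \<Rightarrow> complex) set \<Rightarrow> ('a mat \<Rightarrow> complex) set" where
  "center_of n A = {z \<in> A. \<forall>a\<in>A. galg_mult n z a = galg_mult n a z}"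

definition hecke_T :: "nat \<Rightarrow> 'a::{field,finite} mat \<Rightarrow> 'a mat \<Rightarrow> complex" where
  "hecke_T n w = cscale (1 / of_nat (card (borel_subgroup n :: 'a mat set))) (indicator (double_coset n w))"

definition hecke_algebra :: "nat \<Rightarrow> ('a::{field,finite} mat \<Rightarrow> complex) set" where
  "hecke_algebra n = cfun.span (hecke_T n ` weyl_group n)"

definition flag_vector :: "nat \<Rightarrow> 'a::{field,finite} mat \<Rightarrow> 'a mat \<Rightarrow> complex" where
  "flag_vector n g =
     cscale (1 / of_nat (card (borel_subgroup n :: 'a mat set))) (indicator (g <#\<^bsub>GL n\<^esub> borel_subgroup n))"

definition flag_rep :: "nat \<Rightarrow> ('a::{field,finite} mat \<Rightarrow> complex) set" where
  "flag_rep n = cfun.span (flag_vector n ` carrier (GL n))"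

definition flag_action ::
  "nat \<Rightarrow> 'a::{field,finite} mat \<Rightarrow> ('a mat \<Rightarrow> complex) \<Rightarrow> ('a mat \<Rightarrow> complex) \<Rightarrow> 'a mat \<Rightarrow> complex" where
  "flag_action n g h v = galg_mult n (galg_mult n (indicator {g}) v) h"

definition flag_trace :: "nat \<Rightarrow> 'a::{field,finite} mat \<Rightarrow> ('a mat \<Rightarrow> complex) \<Rightarrow> complex" where
  "flag_trace n g h = trace_on (flag_rep n) (flag_action n g h)"

definition qlen :: "nat \<Rightarrow> 'a::{field,finite} mat \<Rightarrow> complex" where
  "qlen n w = of_nat (card (UNIV :: 'a set)) powi (- int (weyl_length n w))"


section \<open>Modules\<close>

text \<open>
  A finite-dimensional module is given by matrices in a chosen basis.  A left module is the space of
  column vectors; a right module is the space of row vectors, so that \<open>v \<cdot> h = v\<^sup>T \<rho>(h)\<close> and \<open>\<rho>\<close> is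
  multiplicative (not anti-multiplicative) in both cases.  Row vectors are represented by the type
  \<open>vec\<close>, on which \<open>A\<close> acts from the right as \<open>A\<^sup>T\<close> from the left.
\<close>

definition mat_trace :: "complex mat \<Rightarrow> complex" where
  "mat_trace A = (\<Sum>i<dim_row A. A $$ (i, i))"

definition invariant_subspace :: "nat \<Rightarrow> complex mat set \<Rightarrow> complex vec set \<Rightarrow> bool" where
  "invariant_subspace d S U \<longleftrightarrow>
     U \<subseteq> carrier_vec d \<and> 0\<^sub>v d \<in> U \<and> (\<forall>u\<in>U. \<forall>v\<in>U. u + v \<in> U) \<and> (\<forall>c. \<forall>u\<in>U. c \<cdot>\<^sub>v u \<in> U) \<and>
     (\<forall>A\<in>S. \<forall>u\<in>U. A *\<^sub>v u \<in> U)"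

definition acts_irreducibly :: "nat \<Rightarrow> complex mat set \<Rightarrow> bool" where
  "acts_irreducibly d S \<longleftrightarrow>
     d > 0 \<and> (\<forall>U. invariant_subspace d S U \<longrightarrow> U = {0\<^sub>v d} \<or> U = carrier_vec d)"

definition irreducible_G_module :: "nat \<Rightarrow> nat \<Rightarrow> ('a::{field,finite} mat \<Rightarrow> complex mat) \<Rightarrow> bool" where
  "irreducible_G_module n d \<rho> \<longleftrightarrow>
     \<rho> \<in> hom (GL n) (GL d) \<and> acts_irreducibly d (\<rho> ` carrier (GL n))"

definition H_module ::
  "nat \<Rightarrow> nat \<Rightarrow> (('a::{field,finite} mat \<Rightarrow> complex) \<Rightarrow> complex mat) \<Rightarrow> bool" where
  "H_module n d \<rho> \<longleftrightarrow>
     (\<forall>h \<in> hecke_algebra n. \<rho> h \<in> carrier_mat d d) \<and>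
     (\<forall>h \<in> hecke_algebra n. \<forall>k \<in> hecke_algebra n. \<rho> (h + k) = \<rho> h + \<rho> k) \<and>
     (\<forall>c. \<forall>h \<in> hecke_algebra n. \<rho> (cscale c h) = c \<cdot>\<^sub>m \<rho> h) \<and>
     (\<forall>h \<in> hecke_algebra n. \<forall>k \<in> hecke_algebra n. \<rho> (galg_mult n h k) = \<rho> h * \<rho> k) \<and>
     \<rho> (hecke_T n (1\<^sub>m n)) = 1\<^sub>m d"

definition irreducible_H_module ::
  "nat \<Rightarrow> nat \<Rightarrow> (('a::{field,finite} mat \<Rightarrow> complex) \<Rightarrow> complex mat) \<Rightarrow> bool" where
  "irreducible_H_module n d \<rho> \<longleftrightarrow>
     H_module n d \<rho> \<and> acts_irreducibly d ((\<lambda>h. transpose_mat (\<rho> h)) ` hecke_algebra n)"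

definition H_module_iso ::
  "nat \<Rightarrow> nat \<Rightarrow> (('a::{field,finite} mat \<Rightarrow> complex) \<Rightarrow> complex mat) \<Rightarrow>
   nat \<Rightarrow> (('a mat \<Rightarrow> complex) \<Rightarrow> complex mat) \<Rightarrow> bool" where
  "H_module_iso n d \<rho> d' \<rho>' \<longleftrightarrow>
     d = d' \<and> (\<exists>P \<in> carrier (GL d). \<forall>h \<in> hecke_algebra n. \<rho> h * P = P * \<rho>' h)"

text \<open>\<open>(H\<^sup>\<lambda>)\<close>, \<open>\<lambda> \<in> \<Lambda>\<close>, is a complete irredundant family of irreducible right \<open>H\<close>-modules.\<close>

definition H_irreducibles ::
  "nat \<Rightarrow> 'l set \<Rightarrow> ('l \<Rightarrow> nat) \<Rightarrow> ('l \<Rightarrow> ('a::{field,finite} mat \<Rightarrow> complex) \<Rightarrow> complex mat) \<Rightarrow> bool" where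
  "H_irreducibles n \<Lambda> dH \<rho>H \<longleftrightarrow>
     finite \<Lambda> \<and>
     (\<forall>l\<in>\<Lambda>. irreducible_H_module n (dH l) (\<rho>H l)) \<and>
     (\<forall>l\<in>\<Lambda>. \<forall>m\<in>\<Lambda>. H_module_iso n (dH l) (\<rho>H l) (dH m) (\<rho>H m) \<longrightarrow> l = m) \<and>
     (\<forall>d \<rho>. irreducible_H_module n d \<rho> \<longrightarrow> (\<exists>l\<in>\<Lambda>. H_module_iso n d \<rho> (dH l) (\<rho>H l)))"

text \<open>
  \<open>(G\<^sup>\<lambda>)\<close> is the family of irreducible \<open>G\<close>-modules corresponding to \<open>(H\<^sup>\<lambda>)\<close>, that is, the flag
  representation is isomorphic to \<open>\<Oplus>\<^sub>\<lambda> G\<^sup>\<lambda> \<otimes> H\<^sup>\<lambda>\<close> as a bimodule.  The tensor product of column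
  vectors of length \<open>dG\<close> and row vectors of length \<open>dH\<close> is the space of \<open>dG \<times> dH\<close> matrices
  (\<open>u \<otimes> v = u v\<^sup>T\<close>), on which \<open>G\<close> acts by left and \<open>H\<close> by right multiplication.
\<close>

definition flag_bimodule_decomposition ::
  "nat \<Rightarrow> 'l set \<Rightarrow> ('l \<Rightarrow> nat) \<Rightarrow> ('l \<Rightarrow> 'a::{field,finite} mat \<Rightarrow> complex mat) \<Rightarrow>
   ('l \<Rightarrow> nat) \<Rightarrow> ('l \<Rightarrow> ('a mat \<Rightarrow> complex) \<Rightarrow> complex mat) \<Rightarrow> bool" where
  "flag_bimodule_decomposition n \<Lambda> dG \<rho>G dH \<rho>H \<longleftrightarrow>
     (\<forall>l\<in>\<Lambda>. irreducible_G_module n (dG l) (\<rho>G l)) \<and>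
     (\<exists>\<Phi>. bij_betw \<Phi> (flag_rep n) (\<Pi>\<^sub>E l\<in>\<Lambda>. carrier_mat (dG l) (dH l)) \<and>
        (\<forall>v \<in> flag_rep n. \<forall>u \<in> flag_rep n. \<forall>l\<in>\<Lambda>. \<Phi> (v + u) l = \<Phi> v l + \<Phi> u l) \<and>
        (\<forall>c. \<forall>v \<in> flag_rep n. \<forall>l\<in>\<Lambda>. \<Phi> (cscale c v) l = c \<cdot>\<^sub>m \<Phi> v l) \<and>
        (\<forall>g \<in> carrier (GL n). \<forall>h \<in> hecke_algebra n. \<forall>v \<in> flag_rep n. \<forall>l\<in>\<Lambda>.
            \<Phi> (flag_action n g h v) l = \<rho>G l g * \<Phi> v l * \<rho>H l h))"

text \<open>The minimal central idempotent \<open>z\<^sub>\<lambda>\<^sup>H\<close>, where \<open>\<rho>\<close> and \<open>\<sigma>\<close> are the matrices of \<open>G\<^sup>\<lambda>\<close> and \<open>H\<^sup>\<lambda>\<close>.\<close>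

definition central_idempotent ::
  "nat \<Rightarrow> ('a::{field,finite} mat \<Rightarrow> complex mat) \<Rightarrow> (('a mat \<Rightarrow> complex) \<Rightarrow> complex mat) \<Rightarrow>
   'a mat \<Rightarrow> complex" where
  "central_idempotent n \<rho> \<sigma> =
     cscale (mat_trace (\<rho> (1\<^sub>m n)) / of_nat (card (flags n :: 'a mat set set)))
       (\<Sum>w\<in>weyl_group n. cscale (mat_trace (\<sigma> (hecke_T n w)) * qlen n w) (hecke_T n (inv\<^bsub>GL n\<^esub> w)))"


section \<open>Central elements\<close>

text \<open>
  \<open>k \<nu> w\<close> is the coefficient \<open>\<kappa>\<^bsub>\<nu>,w\<^esub>\<close>.  The dual-basis condition is imposed at every minimal length
  element of every class; together with being a basis of the centre it determines the family.
\<close>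

definition geck_rouquier_basis ::
  "nat \<Rightarrow> ('a::{field,finite} mat set \<Rightarrow> 'a mat \<Rightarrow> complex) \<Rightarrow> bool" where
  "geck_rouquier_basis n \<kappa> \<longleftrightarrow>
     inj_on \<kappa> (weyl_classes n) \<and>
     cfun.independent (\<kappa> ` weyl_classes n) \<and>
     cfun.span (\<kappa> ` weyl_classes n) = center_of n (hecke_algebra n) \<and>
     (\<exists>k. \<forall>\<nu>\<in>weyl_classes n.
        \<kappa> \<nu> = (\<Sum>w\<in>weyl_group n. cscale (k \<nu> w * qlen n w) (hecke_T n w)) \<and>
        (\<forall>\<mu>\<in>weyl_classes n. \<forall>w\<in>min_length_elements n \<mu>. k \<nu> w = (if \<nu> = \<mu> then 1 else 0)))"

definition A_elem :: "nat \<Rightarrow> 'a::{field,finite} mat \<Rightarrow> 'a mat \<Rightarrow> complex" where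
  "A_elem n g =
     (\<Sum>w\<in>weyl_group n. cscale (flag_trace n g (hecke_T n w) * qlen n w) (hecke_T n (inv\<^bsub>GL n\<^esub> w)))"

text \<open>The element \<open>(|G/B| / |\<C>\<^sub>g|) C\<^sub>g\<close> of the group algebra.\<close>

definition scaled_class_sum :: "nat \<Rightarrow> 'a::{field,finite} mat \<Rightarrow> 'a mat \<Rightarrow> complex" where
  "scaled_class_sum n g =
     cscale (of_nat (card (flags n :: 'a mat set set)) / of_nat (card (GL_class n g)))
       (indicator (GL_class n g))"

end

theory Submission
  imports Defs "Jordan_Normal_Form.Determinant" "HOL-Combinatorics.Cycles"
begin

text \<open>
  Write \<open>E = T\<^sub>1\<close> for the average over \<open>B\<close> and \<open>q\<close> for the number of elements of the field.  The flag
  representation is \<open>\<complex>G E\<close>, spanned by the vectors \<open>v\<^sub>x = x E\<close>, and \<open>H\<close> acts on it from the right.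

  The coefficient of \<open>v\<^sub>x\<close> in \<open>g v\<^sub>x T\<^sub>w\<close> is 1 if \<open>x\<^sup>-\<^sup>1 g\<^sup>-\<^sup>1 x \<in> B w B\<close> and 0 otherwise, so the trace of
  \<open>g T\<^sub>w\<close> counts the points of the Lusztig variety.  Sorting the same \<open>x\<close> by the value of
  \<open>x\<^sup>-\<^sup>1 g x\<close>, which takes every value in the conjugacy class equally often, gives the formula with
  \<open>\<C>\<^sub>g \<inter> B w\<^sup>-\<^sup>1 B\<close>.  The character formula is the trace of \<open>X \<mapsto> \<rho>\<^sub>G(g) X \<rho>\<^sub>H(T\<^sub>w)\<close> on matrix blocks.
  Both evaluations of the trace rest on \<open>trace_on_frame\<close>, which computes a trace from any finite
  spanning family with linear coordinates.

  By the Bruhat decomposition (\<open>GL_in_double_coset\<close>, \<open>weyl_group_double_coset_eq\<close>) and the formula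
  \<open>|B w B| = |B| q\<^bsup>l(w)\<^esup>\<close> (\<open>card_double_coset\<close>), the class formula for the traces says exactly that
  \<open>A\<^sub>g = E S E\<close> for the central element \<open>S = |G/B| / |\<C>\<^sub>g| \<cdot> C\<^sub>g\<close> of \<open>\<complex>G\<close> (\<open>A_elem_eq_sandwich\<close>).  As \<open>E\<close> is the
  unit of \<open>H\<close> and fixes the flag representation from the right, \<open>A\<^sub>g\<close> acts there as \<open>S\<close> and commutes
  with \<open>H\<close>.  Its coordinates in the Geck--Rouquier basis are read off from its coefficients at
  minimal length elements; that these can be taken at \<open>\<gamma>\<^sup>-\<^sup>1\<close> uses that a permutation is conjugate to
  its inverse (\<open>permutation_conj_inverse\<close>).  The expansion in central idempotents is the character
  formula inserted into the definition of \<open>A\<^sub>g\<close>.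
\<close>


section \<open>Counting in finite groups\<close>

lemma card_preimage_uniform_fibres:
  assumes "finite A" and k: "\<And>y. y \<in> f ` A \<Longrightarrow> card {x \<in> A. f x = y} = k"
  shows "card {x \<in> A. f x \<in> S} = k * card (S \<inter> f ` A)"
proof -
  have "{x \<in> A. f x \<in> S} = (\<Union>y \<in> S \<inter> f ` A. {x \<in> A. f x = y})"
    by auto
  also have "card \<dots> = (\<Sum>y \<in> S \<inter> f ` A. card {x \<in> A. f x = y})"
    using \<open>finite A\<close> by (intro card_UN_disjoint) auto
  also have "\<dots> = k * card (S \<inter> f ` A)"
    using k by simp
  finally show ?thesis .
qed

context group
begin

lemma inv_mult_cancel [simp]:
  "\<lbrakk>x \<in> carrier G; y \<in> carrier G\<rbrakk> \<Longrightarrow> inv x \<otimes> (x \<otimes> y) = y"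
  "\<lbrakk>x \<in> carrier G; y \<in> carrier G\<rbrakk> \<Longrightarrow> x \<otimes> (inv x \<otimes> y) = y"
  by (simp_all flip: m_assoc)

lemmas word_simps = m_assoc inv_mult_group

text \<open>
  Each nonempty fibre of \<open>(b, b') \<mapsto> b x b'\<close> is a copy of \<open>H \<inter> x H x\<^sup>-\<^sup>1\<close>: relative to a chosen pair
  \<open>(c, c')\<close> in the fibre, any other pair is given by \<open>d = c\<^sup>-\<^sup>1 b\<close>, which then determines \<open>b'\<close>.
\<close>

lemma card_double_coset_preimage:
  assumes H: "subgroup H G" "finite H" and x: "x \<in> carrier G"
  shows "card {(b, b') \<in> H \<times> H. b \<otimes> x \<otimes> b' \<in> S} =
           card {d \<in> H. inv x \<otimes> d \<otimes> x \<in> H} * card (S \<inter> {b \<otimes> x \<otimes> b' | b b'. b \<in> H \<and> b' \<in> H})"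
proof -
  interpret H: subgroup H G by fact
  note [simp] = H.mem_carrier x
  let ?f = "\<lambda>(b, b'). b \<otimes> x \<otimes> b'"
  have "card {p \<in> H \<times> H. ?f p \<in> S} =
      card {d \<in> H. inv x \<otimes> d \<otimes> x \<in> H} * card (S \<inter> ?f ` (H \<times> H))"
  proof (rule card_preimage_uniform_fibres)
    fix z assume "z \<in> ?f ` (H \<times> H)"
    then obtain c c' where c: "c \<in> H" "c' \<in> H" "z = c \<otimes> x \<otimes> c'" by auto
    let ?g = "\<lambda>d. (c \<otimes> d, inv x \<otimes> inv d \<otimes> x \<otimes> c')"
    have "bij_betw ?g {d \<in> H. inv x \<otimes> d \<otimes> x \<in> H} {p \<in> H \<times> H. ?f p = z}"
    proof (rule bij_betw_byWitness[where f' = "\<lambda>(b, b'). inv c \<otimes> b"])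
      show "\<forall>d \<in> {d \<in> H. inv x \<otimes> d \<otimes> x \<in> H}. (\<lambda>(b, b'). inv c \<otimes> b) (?g d) = d"
        using c by auto
      show "\<forall>p \<in> {p \<in> H \<times> H. ?f p = z}. ?g ((\<lambda>(b, b'). inv c \<otimes> b) p) = p"
      proof
        fix p assume "p \<in> {p \<in> H \<times> H. ?f p = z}"
        then obtain b b' where b: "p = (b, b')" "b \<in> H" "b' \<in> H" "b \<otimes> x \<otimes> b' = z" by auto
        have "c \<otimes> (x \<otimes> c') = b \<otimes> (x \<otimes> b')" using b c by (simp add: m_assoc)
        then have "inv x \<otimes> (inv b \<otimes> (c \<otimes> (x \<otimes> c'))) = b'" using b c by simp
        then show "?g ((\<lambda>(b, b'). inv c \<otimes> b) p) = p"
          using b c by (simp add: word_simps)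
      qed
      show "?g ` {d \<in> H. inv x \<otimes> d \<otimes> x \<in> H} \<subseteq> {p \<in> H \<times> H. ?f p = z}"
      proof safe
        fix d assume d: "d \<in> H" "inv x \<otimes> d \<otimes> x \<in> H"
        have "inv x \<otimes> inv d \<otimes> x = inv (inv x \<otimes> d \<otimes> x)"
          using d by (simp add: word_simps)
        then show "inv x \<otimes> inv d \<otimes> x \<otimes> c' \<in> H"
          using d c by simp
      qed (use c in \<open>auto simp: word_simps\<close>)
      show "(\<lambda>(b, b'). inv c \<otimes> b) ` {p \<in> H \<times> H. ?f p = z} \<subseteq> {d \<in> H. inv x \<otimes> d \<otimes> x \<in> H}"
      proof (rule image_subsetI)
        fix p assume "p \<in> {p \<in> H \<times> H. ?f p = z}"
        then obtain b b' where b: "p = (b, b')" "b \<in> H" "b' \<in> H" "b \<otimes> x \<otimes> b' = z" by auto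
        have "c \<otimes> (x \<otimes> c') = b \<otimes> (x \<otimes> b')" using b c by (simp add: m_assoc)
        moreover have "b = b \<otimes> (x \<otimes> b') \<otimes> inv b' \<otimes> inv x"
          using b(2,3) by (simp add: m_assoc)
        ultimately have "b = c \<otimes> (x \<otimes> c') \<otimes> inv b' \<otimes> inv x"
          by simp
        then have "inv x \<otimes> (inv c \<otimes> b) \<otimes> x = c' \<otimes> inv b'"
          using b c by (simp add: word_simps)
        then show "(\<lambda>(b, b'). inv c \<otimes> b) p \<in> {d \<in> H. inv x \<otimes> d \<otimes> x \<in> H}"
          using b c by simp
      qed
    qed
    then show "card {p \<in> H \<times> H. ?f p = z} = card {d \<in> H. inv x \<otimes> d \<otimes> x \<in> H}"
      by (rule bij_betw_same_card[symmetric])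
  qed (use H in simp)
  moreover have "?f ` (H \<times> H) = {b \<otimes> x \<otimes> b' | b b'. b \<in> H \<and> b' \<in> H}"
    by auto
  moreover have "{p \<in> H \<times> H. ?f p \<in> S} = {(b, b') \<in> H \<times> H. b \<otimes> x \<otimes> b' \<in> S}"
    by auto
  ultimately show ?thesis by simp
qed

text \<open>
  The nonempty fibres of \<open>x \<mapsto> x\<^sup>-\<^sup>1 g x\<close> are the right cosets of the centralizer of \<open>g\<close>.
\<close>

lemma card_conjugation_preimage:
  assumes fin: "finite (carrier G)" and g: "g \<in> carrier G"
  defines "C \<equiv> {x \<otimes> g \<otimes> inv x | x. x \<in> carrier G}"
  shows "card {x \<in> carrier G. inv x \<otimes> g \<otimes> x \<in> S} * card C = card (carrier G) * card (C \<inter> S)"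
proof -
  let ?f = "\<lambda>x. inv x \<otimes> g \<otimes> x"
  let ?Z = "{x \<in> carrier G. ?f x = g}"
  have C: "?f ` carrier G = C"
  proof (intro equalityI subsetI)
    fix y assume "y \<in> ?f ` carrier G"
    then obtain x where "x \<in> carrier G" "y = ?f x" by auto
    then show "y \<in> C" unfolding C_def by (intro CollectI exI[of _ "inv x"]) auto
  next
    fix y assume "y \<in> C"
    then obtain x where "x \<in> carrier G" "y = ?f (inv x)" by (auto simp: C_def)
    then show "y \<in> ?f ` carrier G" by blast
  qed
  have *: "card {x \<in> carrier G. ?f x \<in> T} = card ?Z * card (T \<inter> C)" for T
    unfolding C[symmetric]
  proof (rule card_preimage_uniform_fibres[OF fin])
    fix z assume "z \<in> ?f ` carrier G"
    then obtain c where c: "c \<in> carrier G" "z = ?f c" by auto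
    have "bij_betw (\<lambda>x. x \<otimes> c) ?Z {x \<in> carrier G. ?f x = z}"
    proof (rule bij_betw_byWitness[where f' = "\<lambda>x. x \<otimes> inv c"])
      show "(\<lambda>x. x \<otimes> c) ` ?Z \<subseteq> {x \<in> carrier G. ?f x = z}"
      proof safe
        fix x assume x: "x \<in> carrier G" "?f x = g"
        then show "?f (x \<otimes> c) = z"
          using c g by (simp add: word_simps) (metis g inv_closed m_assoc m_closed)
      qed (use c in auto)
      show "(\<lambda>x. x \<otimes> inv c) ` {x \<in> carrier G. ?f x = z} \<subseteq> ?Z"
      proof (rule image_subsetI)
        fix x assume "x \<in> {x \<in> carrier G. ?f x = z}"
        then have x: "x \<in> carrier G" "?f x = ?f c" using c by auto
        have "?f (x \<otimes> inv c) = c \<otimes> ?f x \<otimes> inv c"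
          using x(1) c g by (simp add: word_simps)
        also have "\<dots> = g"
          unfolding x(2) using c g by (simp add: word_simps)
        finally show "x \<otimes> inv c \<in> ?Z" using x c by simp
      qed
    qed (use c in \<open>auto simp: m_assoc\<close>)
    then show "card {x \<in> carrier G. ?f x = z} = card ?Z"
      by (rule bij_betw_same_card[symmetric])
  qed
  have "card (carrier G) = card ?Z * card C"
    using *[of UNIV] by simp
  then show ?thesis
    using *[of S] by (simp add: Int_commute)
qed

text \<open>Right multiplication by an element of a finite submonoid permutes it.\<close>

lemma finite_submonoid_subgroup:
  assumes H: "H \<subseteq> carrier G" "finite H" "\<one> \<in> H" "\<And>x y. x \<in> H \<Longrightarrow> y \<in> H \<Longrightarrow> x \<otimes> y \<in> H"
  shows "subgroup H G"
proof (rule subgroupI)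
  fix a assume a: "a \<in> H"
  have "inj_on (\<lambda>x. x \<otimes> a) H" using H a by (intro inj_onI) (auto simp: subset_iff)
  then have "(\<lambda>x. x \<otimes> a) ` H = H"
    using H a by (intro card_subset_eq) (auto simp: card_image)
  then obtain x where "x \<in> H" "x \<otimes> a = \<one>" using \<open>\<one> \<in> H\<close> by (metis imageE)
  then show "inv a \<in> H" using H a inv_equality by (metis subsetD)
qed (use H in auto)

end


section \<open>The general linear group and its Borel subgroup\<close>

lemma carrier_GL: "carrier (GL n :: 'a::field mat monoid) = {A \<in> carrier_mat n n. det A \<noteq> 0}"
  using unit_imp_det_non_zero[of _ n "()"] det_non_zero_imp_unit[of _ n "()"]
  unfolding GL_def units_of_carrier by (auto simp: Units_def ring_mat_simps)

lemma mult_GL: "x \<otimes>\<^bsub>GL n\<^esub> y = x * y"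
  by (simp add: GL_def units_of_mult ring_mat_simps)

lemma one_GL: "\<one>\<^bsub>GL n\<^esub> = 1\<^sub>m n"
  by (simp add: GL_def units_of_one ring_mat_simps)

lemma group_GL: "group (GL n :: 'a::field mat monoid)"
proof -
  interpret R: ring "ring_mat TYPE('a) n ()" by (rule ring_mat)
  show ?thesis unfolding GL_def by (rule R.units_group)
qed

lemma finite_carrier_mat: "finite (carrier_mat m n :: 'a::finite mat set)"
proof (rule finite_imageD)
  let ?f = "\<lambda>A :: 'a mat. restrict (\<lambda>ij. A $$ ij) ({..<m} \<times> {..<n})"
  have "?f ` carrier_mat m n \<subseteq> ({..<m} \<times> {..<n}) \<rightarrow>\<^sub>E UNIV"
    by (intro image_subsetI restrict_PiE_iff[THEN iffD2]) simp
  then show "finite (?f ` carrier_mat m n)"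
    by (rule finite_subset) (auto intro!: finite_PiE)
  show "inj_on ?f (carrier_mat m n)"
  proof (intro inj_onI eq_matI)
    fix A B :: "'a mat" and i j
    assume "A \<in> carrier_mat m n" "B \<in> carrier_mat m n" "?f A = ?f B" "i < dim_row B" "j < dim_col B"
    then show "A $$ (i, j) = B $$ (i, j)"
      by (auto dest!: fun_cong[where x = "(i, j)"])
  qed auto
qed

lemma finite_GL [simp]: "finite (carrier (GL n :: 'a::{field,finite} mat monoid))"
  using finite_carrier_mat by (rule finite_subset[rotated]) (auto simp: carrier_GL)

text \<open>
  The rewriting makes the group laws available for the matrix product itself.  There \<open>n\<close> occurs
  only in the premises, so the laws are instantiated with \<open>n\<close> when they serve as rewrite rules.
\<close>

global_interpretation GL: group "GL n :: 'a::field mat monoid"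
  rewrites "mult (GL n :: 'a mat monoid) = (*)" and "one (GL n :: 'a mat monoid) = 1\<^sub>m n"
  for n :: nat
  by (rule group_GL) (simp_all add: mult_GL one_GL fun_eq_iff)

lemma GL_carrier_mat: "x \<in> carrier (GL n) \<Longrightarrow> x \<in> carrier_mat n n"
  by (simp add: carrier_GL)

lemma index_mult_mat_sum:
  assumes "A \<in> carrier_mat m n" "B \<in> carrier_mat n p" "i < m" "j < p"
  shows "(A * B) $$ (i, j) = (\<Sum>k<n. A $$ (i, k) * B $$ (k, j))"
  using assms by (auto simp: scalar_prod_def atLeast0LessThan)

lemma borel_subgroup_iff:
  fixes b :: "'a::field mat"
  shows "b \<in> borel_subgroup n \<longleftrightarrow>
    b \<in> carrier_mat n n \<and> (\<forall>i<n. b $$ (i, i) \<noteq> 0) \<and> (\<forall>i<n. \<forall>j<i. b $$ (i, j) = 0)"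
proof (cases "b \<in> carrier_mat n n \<and> upper_triangular b")
  case True
  then have "det b = 0 \<longleftrightarrow> (\<exists>i<n. b $$ (i, i) = 0)"
    by (subst upper_triangular_imp_det_eq_0_iff) (auto simp: diag_mat_def image_iff)
  then show ?thesis
    using True by (auto simp: borel_subgroup_def carrier_GL upper_triangular_def)
qed (auto simp: borel_subgroup_def carrier_GL upper_triangular_def)

lemma borel_subgroup_GL: "b \<in> borel_subgroup n \<Longrightarrow> b \<in> carrier (GL n)"
  by (simp add: borel_subgroup_def)

lemma finite_borel_subgroup [simp]: "finite (borel_subgroup n :: 'a::{field,finite} mat set)"
  using finite_GL[of n] by (rule finite_subset[rotated]) (auto simp: borel_subgroup_def)

lemma upper_triangular_mult:
  fixes A B :: "'a::semiring_0 mat"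
  assumes "A \<in> carrier_mat n n" "B \<in> carrier_mat n n" "upper_triangular A" "upper_triangular B"
  shows "upper_triangular (A * B)"
proof (rule upper_triangularI)
  fix i j assume "j < i" "i < dim_row (A * B)"
  then have ij: "j < i" "i < n" using assms by auto
  have "A $$ (i, k) * B $$ (k, j) = 0" if "k < n" for k
    using assms ij that by (cases "k < i") (auto simp: upper_triangular_def)
  then show "(A * B) $$ (i, j) = 0"
    using assms ij by (simp add: index_mult_mat_sum del: index_mult_mat)
qed

lemma subgroup_borel: "subgroup (borel_subgroup n) (GL n :: 'a::{field,finite} mat monoid)"
proof (rule GL.finite_submonoid_subgroup)
  fix x y :: "'a mat" assume "x \<in> borel_subgroup n" "y \<in> borel_subgroup n"
  then show "x * y \<in> borel_subgroup n"
    by (auto simp: borel_subgroup_def intro: upper_triangular_mult[OF GL_carrier_mat GL_carrier_mat])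
qed (use finite_borel_subgroup in \<open>auto simp: borel_subgroup_def\<close>)

global_interpretation borel: subgroup "borel_subgroup n" "GL n :: 'a::{field,finite} mat monoid"
  rewrites "mult (GL n :: 'a mat monoid) = (*)" and "one (GL n :: 'a mat monoid) = 1\<^sub>m n"
  for n :: nat
  by (rule subgroup_borel) (simp_all add: mult_GL one_GL fun_eq_iff)

lemma borel_subgroup_nonempty [simp]: "(borel_subgroup n :: 'a::{field,finite} mat set) \<noteq> {}"
  using borel.one_closed by blast

lemma card_borel_pos: "card (borel_subgroup n :: 'a::{field,finite} mat set) > 0"
  using finite_borel_subgroup borel.one_closed by (metis card_gt_0_iff empty_iff)


section \<open>Permutation matrices\<close>

lemma perm_mat_carrier: "perm_mat n p \<in> carrier_mat n n"
  by (simp add: perm_mat_def)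

lemma perm_mat_id: "perm_mat n id = 1\<^sub>m n"
  by (auto simp: perm_mat_def)

lemma index_mult_perm_mat:
  fixes A :: "'a::field mat"
  assumes "p permutes {..<n}" "A \<in> carrier_mat n n" "i < n" "j < n"
  shows "(A * perm_mat n p) $$ (i, j) = A $$ (i, p j)"
proof -
  have "p j < n" using permutes_in_image[OF assms(1), of j] assms by simp
  have "(A * perm_mat n p) $$ (i, j) = (\<Sum>k<n. if k = p j then A $$ (i, k) else 0)"
    using assms by (subst index_mult_mat_sum[of _ n n _ n]) (auto simp: perm_mat_def intro!: sum.cong simp del: sum.delta sum.delta')
  then show ?thesis
    using \<open>p j < n\<close> by simp
qed

lemma index_perm_mat_mult:
  fixes A :: "'a::field mat"
  assumes "p permutes {..<n}" "A \<in> carrier_mat n n" "i < n" "j < n"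
  shows "(perm_mat n p * A) $$ (i, j) = A $$ (Hilbert_Choice.inv p i, j)"
proof -
  have "Hilbert_Choice.inv p i < n"
    using permutes_in_image[OF permutes_inv[OF assms(1)], of i] assms by simp
  have "(perm_mat n p * A) $$ (i, j) =
      (\<Sum>k<n. if k = Hilbert_Choice.inv p i then A $$ (k, j) else 0)"
    using assms permutes_inv_eq[OF assms(1), of i]
    by (subst index_mult_mat_sum[of _ n n _ n]) (auto simp: perm_mat_def intro!: sum.cong simp del: sum.delta sum.delta')
  then show ?thesis
    using \<open>Hilbert_Choice.inv p i < n\<close> by simp
qed

lemma perm_mat_mult:
  assumes "p permutes {..<n}" "q permutes {..<n}"
  shows "perm_mat n p * perm_mat n q = (perm_mat n (p \<circ> q) :: 'a::field mat)"
proof (rule eq_matI)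
  fix i j assume "i < dim_row (perm_mat n (p \<circ> q) :: 'a mat)" "j < dim_col (perm_mat n (p \<circ> q) :: 'a mat)"
  then have ij: "i < n" "j < n" by (simp_all add: perm_mat_def)
  moreover have "q j < n" using permutes_in_image[OF assms(2), of j] ij by simp
  ultimately show "(perm_mat n p * perm_mat n q) $$ (i, j) = (perm_mat n (p \<circ> q) :: 'a mat) $$ (i, j)"
    using assms by (subst index_mult_perm_mat[OF _ perm_mat_carrier]) (auto simp: perm_mat_def)
qed (simp_all add: perm_mat_def)

lemma perm_mat_inv_mult:
  assumes "p permutes {..<n}"
  shows "perm_mat n (Hilbert_Choice.inv p) * perm_mat n p = (1\<^sub>m n :: 'a::field mat)"
  using assms by (simp add: perm_mat_mult permutes_inv permutes_inv_o perm_mat_id)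

lemma perm_mat_GL: "p permutes {..<n} \<Longrightarrow> (perm_mat n p :: 'a::field mat) \<in> carrier (GL n)"
proof -
  assume p: "p permutes {..<n}"
  have "det (perm_mat n (Hilbert_Choice.inv p)) * det (perm_mat n p :: 'a mat) = 1"
    using det_mult[OF perm_mat_carrier perm_mat_carrier, of n "Hilbert_Choice.inv p" p]
      perm_mat_inv_mult[OF p] by (metis det_one)
  then show ?thesis
    by (auto simp: carrier_GL perm_mat_carrier)
qed

lemma inv_perm_mat:
  assumes "p permutes {..<n}"
  shows "inv\<^bsub>GL n\<^esub> (perm_mat n p) = (perm_mat n (Hilbert_Choice.inv p) :: 'a::field mat)"
  using assms by (intro GL.inv_equality) (simp_all add: perm_mat_inv_mult perm_mat_GL permutes_inv)

lemma weyl_group_GL: "w \<in> weyl_group n \<Longrightarrow> w \<in> carrier (GL n)"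
  by (auto simp: weyl_group_def perm_mat_GL)

lemma weyl_group_inv: "w \<in> weyl_group n \<Longrightarrow> inv\<^bsub>GL n\<^esub> w \<in> weyl_group n"
  by (auto simp: weyl_group_def inv_perm_mat permutes_inv)

lemma finite_weyl_group [simp]: "finite (weyl_group n)"
  by (simp add: weyl_group_def finite_permutations)

text \<open>
  On a cycle of \<open>p\<close> with chosen point \<open>r\<close>, the reflection \<open>p\<^sup>k r \<mapsto> p\<^bsup>-k\<^esup> r\<close> reverses the
  direction of \<open>p\<close>.  Negative powers are written as \<open>p\<^bsup>Mk\<^esup>\<close>, where \<open>M + 1\<close> is an exponent with
  \<open>p\<^bsup>M+1\<^esup> = id\<close>.
\<close>

lemma permutation_conj_inverse:
  assumes "p permutes S" "finite S"
  shows "\<exists>s. s permutes S \<and> s \<circ> p \<circ> Hilbert_Choice.inv s = Hilbert_Choice.inv p"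
proof -
  from assms have "permutation p" by (metis permutation_permutes)
  then obtain N where N: "p ^^ N = id" "N > 0" using permutation_is_nilpotent by blast
  define M where "M = N - 1"
  have fold_add: "(p ^^ a) ((p ^^ b) x) = (p ^^ (a + b)) x" for a b x
    by (simp add: funpow_add)
  \<comment> \<open>\<open>p\<^bsup>-a\<^esup> p\<^bsup>a\<^esup> = id\<close>\<close>
  have NM: "(p ^^ (M * a + a + b)) x = (p ^^ b) x" for a b x
  proof -
    have "M * a + a = N * a" using N by (simp add: M_def algebra_simps)
    then have "p ^^ (M * a + a + b) = (p ^^ N) ^^ a \<circ> p ^^ b"
      by (simp only: funpow_add funpow_mult)
    then show ?thesis by (simp add: N)
  qed
  have neg_pow: "(p ^^ (M * a)) x = (p ^^ (M * b)) x" if "(p ^^ a) x = (p ^^ b) x" for a b x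
  proof -
    have "(p ^^ (M * a)) x = (p ^^ (M * b + b + M * a)) x" by (simp add: NM)
    also have "\<dots> = (p ^^ (M * a + M * b)) ((p ^^ b) x)" by (simp add: fold_add ac_simps)
    also have "\<dots> = (p ^^ (M * a + a + M * b)) x" by (simp add: that[symmetric] fold_add ac_simps)
    finally show ?thesis by (simp add: NM)
  qed
  define R where "R x = {y. \<exists>k. (p ^^ k) y = x}" for x
  define r where "r x = (SOME y. y \<in> R x)" for x
  define e where "e x = (SOME k. (p ^^ k) (r x) = x)" for x
  define s where "s x = (p ^^ (M * e x)) (r x)" for x
  have e: "(p ^^ e x) (r x) = x" for x
  proof -
    have "(p ^^ 0) x = x" by simp
    then have "x \<in> R x" unfolding R_def by blast
    then have "r x \<in> R x" unfolding r_def by (rule someI[of "\<lambda>y. y \<in> R x"])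
    then have "\<exists>k. (p ^^ k) (r x) = x" by (simp add: R_def)
    then show ?thesis unfolding e_def by (rule someI_ex[of "\<lambda>k. (p ^^ k) (r x) = x"])
  qed
  have R: "R ((p ^^ m) x) = R x" for m x
  proof (intro equalityI subsetI)
    fix y assume "y \<in> R ((p ^^ m) x)"
    then obtain k where "(p ^^ k) y = (p ^^ m) x" by (auto simp: R_def)
    then have "(p ^^ (M * m + k)) y = (p ^^ (M * m + m + 0)) x" by (simp flip: fold_add)
    then show "y \<in> R x" unfolding NM by (auto simp: R_def)
  next
    fix y assume "y \<in> R x"
    then obtain k where "(p ^^ k) y = x" by (auto simp: R_def)
    then have "(p ^^ (m + k)) y = (p ^^ m) x" by (simp flip: fold_add)
    then show "y \<in> R ((p ^^ m) x)" by (auto simp: R_def)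
  qed
  have s: "s ((p ^^ m) (r x)) = (p ^^ (M * m)) (r x)" for m x
  proof -
    have "R ((p ^^ m) (r x)) = R ((p ^^ e x) (r x))" unfolding R ..
    then have rm: "r ((p ^^ m) (r x)) = r x" unfolding e by (simp add: r_def)
    show ?thesis
      unfolding s_def rm using e[of "(p ^^ m) (r x)"] unfolding rm by (rule neg_pow)
  qed
  have MM: "(p ^^ (M * (M * a))) x = (p ^^ a) x" for a x
  proof -
    have "(p ^^ (M * (M * a))) x = (p ^^ (M * a + a + M * (M * a))) x" by (simp add: NM)
    also have "\<dots> = (p ^^ (M * (M * a) + M * a + a)) x" by (simp add: ac_simps)
    finally show ?thesis by (simp add: NM)
  qed
  have ss: "s (s x) = x" for x
  proof -
    have "s (s x) = (p ^^ (M * (M * e x))) (r x)" unfolding s_def[of x] by (rule s)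
    then show ?thesis by (simp add: MM e)
  qed
  have sp: "p (s (p x)) = s x" for x
  proof -
    have "s ((p ^^ Suc (e x)) (r x)) = (p ^^ (M * Suc (e x))) (r x)" by (rule s)
    then have "p (s (p x)) = (p ^^ (Suc (M * Suc (e x)))) (r x)" by (simp add: e)
    also have "\<dots> = (p ^^ (M * 1 + 1 + M * e x)) (r x)" by (simp add: ac_simps)
    also have "\<dots> = s x" unfolding NM s_def ..
    finally show ?thesis .
  qed
  have "bij s" using ss by (intro involuntory_imp_bij)
  moreover have "s x = x" if "x \<notin> S" for x
  proof -
    have fix1: "(p ^^ k) x = x" for k
      using that assms(1) by (induction k) (auto simp: permutes_not_in)
    have "r x = (p ^^ (M * e x + e x + 0)) (r x)" unfolding NM by simp
    also have "\<dots> = (p ^^ (M * e x)) ((p ^^ e x) (r x))" by (simp add: fold_add)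
    finally have "r x = x" unfolding e fix1 .
    then show ?thesis by (simp add: s_def fix1)
  qed
  ultimately have "s permutes S" by (simp add: permutes_def bij_iff)
  moreover have "Hilbert_Choice.inv s = s" using ss by (intro inv_unique_comp) (auto simp: fun_eq_iff)
  moreover have "s \<circ> p \<circ> s = Hilbert_Choice.inv p"
  proof
    fix x
    have "p (s (p (s x))) = x" by (simp add: sp ss)
    then show "(s \<circ> p \<circ> s) x = Hilbert_Choice.inv p x"
      using permutes_inv_eq[OF assms(1), of x "s (p (s x))"] by simp
  qed
  ultimately show ?thesis by (intro exI[of _ s]) simp
qed


section \<open>The Bruhat decomposition\<close>

lemma double_coset_subset_GL: "w \<in> carrier (GL n) \<Longrightarrow> double_coset n w \<subseteq> carrier (GL n)"
  by (auto simp: double_coset_def borel_subgroup_GL)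

lemma self_in_double_coset:
  fixes w :: "'a::{field,finite} mat"
  assumes "w \<in> carrier (GL n)"
  shows "w \<in> double_coset n w"
  unfolding double_coset_def using assms
  by (auto intro!: exI[of _ "1\<^sub>m n"] borel.one_closed)

lemma mult_double_coset_iff:
  fixes w :: "'a::{field,finite} mat"
  assumes w: "w \<in> carrier (GL n)" and b: "b \<in> borel_subgroup n" and z: "z \<in> carrier (GL n)"
  shows "b * z \<in> double_coset n w \<longleftrightarrow> z \<in> double_coset n w"
    and "z * b \<in> double_coset n w \<longleftrightarrow> z \<in> double_coset n w"
proof -
  note [simp] = borel_subgroup_GL GL.m_assoc[where n = n]
  have left: "c * y \<in> double_coset n w" if "c \<in> borel_subgroup n" "y \<in> double_coset n w" for c y
  proof -
    obtain d d' where "d \<in> borel_subgroup n" "d' \<in> borel_subgroup n" "y = d * w * d'"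
      using \<open>y \<in> _\<close> by (auto simp: double_coset_def)
    moreover from this have "c * y = (c * d) * w * d'" using that w by simp
    ultimately show ?thesis using that unfolding double_coset_def by blast
  qed
  have right: "y * c \<in> double_coset n w" if "c \<in> borel_subgroup n" "y \<in> double_coset n w" for c y
  proof -
    obtain d d' where "d \<in> borel_subgroup n" "d' \<in> borel_subgroup n" "y = d * w * d'"
      using \<open>y \<in> _\<close> by (auto simp: double_coset_def)
    moreover from this have "y * c = d * w * (d' * c)" using that w by simp
    ultimately show ?thesis using that unfolding double_coset_def by blast
  qed
  show "b * z \<in> double_coset n w \<longleftrightarrow> z \<in> double_coset n w"
    using left[OF b, of z] left[of "inv\<^bsub>GL n\<^esub> b" "b * z"] b z by auto
  show "z * b \<in> double_coset n w \<longleftrightarrow> z \<in> double_coset n w"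
    using right[OF b, of z] right[of "inv\<^bsub>GL n\<^esub> b" "z * b"] b z by auto
qed

lemma inv_double_coset_iff:
  fixes w :: "'a::{field,finite} mat"
  assumes w: "w \<in> carrier (GL n)" and z: "z \<in> carrier (GL n)"
  shows "inv\<^bsub>GL n\<^esub> z \<in> double_coset n w \<longleftrightarrow> z \<in> double_coset n (inv\<^bsub>GL n\<^esub> w)"
proof -
  have *: "inv\<^bsub>GL n\<^esub> y \<in> double_coset n (inv\<^bsub>GL n\<^esub> v)"
    if v: "v \<in> carrier (GL n)" and y: "y \<in> double_coset n v" for v y :: "'a mat"
  proof -
    obtain d d' where d: "d \<in> borel_subgroup n" "d' \<in> borel_subgroup n" "y = d * v * d'"
      using y by (auto simp: double_coset_def)
    then have "inv\<^bsub>GL n\<^esub> y = inv\<^bsub>GL n\<^esub> d' * inv\<^bsub>GL n\<^esub> v * inv\<^bsub>GL n\<^esub> d"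
      using v by (simp add: borel_subgroup_GL GL.word_simps[where n = n])
    then show ?thesis
      using d by (auto simp: double_coset_def)
  qed
  show ?thesis
    using *[OF w, of "inv\<^bsub>GL n\<^esub> z"] *[of "inv\<^bsub>GL n\<^esub> w" z] w z by auto
qed

text \<open>
  Suppose \<open>c M\<^sub>p = M\<^sub>q b'\<close> with \<open>c, b' \<in> B\<close>.  The entry in row \<open>p j\<close> and column \<open>j\<close> is on the left a
  diagonal entry of \<open>c\<close>, hence nonzero, and on the right the entry of \<open>b'\<close> in row
  \<open>q\<^sup>-\<^sup>1 (p j)\<close> and column \<open>j\<close>.  So \<open>q\<^sup>-\<^sup>1 (p j) \<le> j\<close> for all \<open>j\<close>, which forces \<open>q\<^sup>-\<^sup>1 p = id\<close>.
\<close>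

lemma double_coset_perm_mat_inj:
  assumes p: "p permutes {..<n}" and q: "q permutes {..<n}"
    and mem: "(perm_mat n p :: 'a::{field,finite} mat) \<in> double_coset n (perm_mat n q)"
  shows "p = q"
proof -
  obtain b b' :: "'a mat" where b: "b \<in> borel_subgroup n" "b' \<in> borel_subgroup n"
    and eq: "perm_mat n p = b * perm_mat n q * b'"
    using mem by (auto simp: double_coset_def)
  let ?c = "inv\<^bsub>GL n\<^esub> b"
  have c: "?c \<in> borel_subgroup n" using b by simp
  have "?c * perm_mat n p = perm_mat n q * b'"
    unfolding eq using b q by (simp add: borel_subgroup_GL GL.m_assoc[where n = n] perm_mat_GL)
  then have entry: "?c $$ (i, p j) = b' $$ (Hilbert_Choice.inv q i, j)" if "i < n" "j < n" for i j
    using that b c p q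
    by (metis index_mult_perm_mat index_perm_mat_mult borel_subgroup_iff)
  have "(Hilbert_Choice.inv q \<circ> p) j \<le> j" if "j < n" for j
  proof (rule ccontr)
    assume "\<not> (Hilbert_Choice.inv q \<circ> p) j \<le> j"
    moreover have "p j < n" using p that permutes_in_image[of p "{..<n}" j] by simp
    moreover from this have "Hilbert_Choice.inv q (p j) < n"
      using permutes_in_image[OF permutes_inv[OF q], of "p j"] by simp
    ultimately have "?c $$ (p j, p j) = 0"
      using entry[of "p j" j] that b by (simp add: borel_subgroup_iff)
    then show False using c \<open>p j < n\<close> by (simp add: borel_subgroup_iff)
  qed
  then have "Hilbert_Choice.inv q \<circ> p = id"
    using p q by (intro permutes_natset_le[OF permutes_compose[OF p permutes_inv[OF q]]]) simp
  then have "q \<circ> (Hilbert_Choice.inv q \<circ> p) = q" by simp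
  then show ?thesis
    using permutes_inv_o(1)[OF q] by (simp flip: comp_assoc)
qed

lemma weyl_group_double_coset_eq:
  fixes u w :: "'a::{field,finite} mat"
  assumes "u \<in> weyl_group n" "w \<in> weyl_group n" "x \<in> double_coset n u" "x \<in> double_coset n w"
  shows "u = w"
proof -
  obtain b b' where b: "b \<in> borel_subgroup n" "b' \<in> borel_subgroup n" "x = b * u * b'"
    using assms by (auto simp: double_coset_def)
  moreover have "u \<in> carrier (GL n)" "w \<in> carrier (GL n)"
    using assms by (auto intro: weyl_group_GL)
  ultimately have "u \<in> double_coset n w"
    using assms(4) mult_double_coset_iff[of w n b u] mult_double_coset_iff[of w n b' "b * u"]
    by (simp add: borel_subgroup_GL)
  then show ?thesis
    using assms double_coset_perm_mat_inj by (auto simp: weyl_group_def)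
qed

lemma GL_nonzero_in_column:
  assumes x: "x \<in> carrier (GL n)" and "k < n"
  shows "\<exists>i<n. x $$ (i, k) \<noteq> 0"
proof (rule ccontr)
  assume "\<not> ?thesis"
  then have "(inv\<^bsub>GL n\<^esub> x * x) $$ (k, k) = 0"
    using x \<open>k < n\<close> GL_carrier_mat[OF x] GL_carrier_mat[OF GL.inv_closed[OF x]]
    by (subst index_mult_mat_sum[of _ n n _ n]) auto
  then show False
    using x \<open>k < n\<close> by simp
qed

definition cleared_column :: "nat \<Rightarrow> 'a::zero mat \<Rightarrow> nat \<Rightarrow> nat \<Rightarrow> bool" where
  "cleared_column n y j r \<longleftrightarrow> r < n \<and> y $$ (r, j) \<noteq> 0 \<and>
     (\<forall>i<n. i \<noteq> r \<longrightarrow> y $$ (i, j) = 0) \<and> (\<forall>l<n. l \<noteq> j \<longrightarrow> y $$ (r, l) = 0)"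

text \<open>
  Gaussian elimination from both sides by \<open>B\<close>.  Left multiplication by \<open>B\<close> may add multiples of a
  row to the rows above it, and right multiplication multiples of a column to the columns to its
  right.  The pivot in column \<open>k\<close> is therefore the lowest nonzero entry of that column; it clears the
  rest of the column, and afterwards the rest of its row.  This does not disturb the columns
  and rows that are already cleared, since they meet the row and the column of the new pivot in
  zeros.
\<close>

lemma clear_columns:
  fixes x :: "'a::{field,finite} mat"
  assumes x: "x \<in> carrier (GL n)"
  shows "k \<le> n \<Longrightarrow> \<exists>y. \<exists>b\<in>borel_subgroup n. \<exists>b'\<in>borel_subgroup n.
           y = b * x * b' \<and> (\<forall>j<k. \<exists>r. cleared_column n y j r)"
proof (induction k)
  case 0
  show ?case using x by (intro exI[of _ x] bexI[of _ "1\<^sub>m n"]) (auto intro: borel.one_closed)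
next
  case (Suc k)
  then obtain y b b' where y: "y = b * x * b'" and b: "b \<in> borel_subgroup n" "b' \<in> borel_subgroup n"
    and "\<forall>j<k. \<exists>r. cleared_column n y j r" by auto
  then obtain r where r: "\<And>j. j < k \<Longrightarrow> cleared_column n y j (r j)" by metis
  have k: "k < n" using Suc.prems by simp
  have yGL: "y \<in> carrier (GL n)" using y b x by (simp add: borel_subgroup_GL)
  note yM = GL_carrier_mat[OF yGL]
  define i where "i = (GREATEST i. i < n \<and> y $$ (i, k) \<noteq> 0)"
  have "i < n \<and> y $$ (i, k) \<noteq> 0"
    unfolding i_def using GL_nonzero_in_column[OF yGL k]
    by (intro GreatestI_ex_nat[where P = "\<lambda>i. i < n \<and> y $$ (i, k) \<noteq> 0" and b = n]) auto
  then have i: "i < n" "y $$ (i, k) \<noteq> 0" by auto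
  have below: "y $$ (a, k) = 0" if "a < n" "i < a" for a
    using Greatest_le_nat[of "\<lambda>i. i < n \<and> y $$ (i, k) \<noteq> 0" a n] that unfolding i_def by auto
  have ir: "i \<noteq> r j" "y $$ (i, j) = 0" if "j < k" for j
  proof -
    show "i \<noteq> r j" using r[OF that] i k that by (auto simp: cleared_column_def)
    then show "y $$ (i, j) = 0" using r[OF that] i by (auto simp: cleared_column_def)
  qed
  \<comment> \<open>\<open>L\<close> clears column \<open>k\<close> above the pivot in row \<open>i\<close>; \<open>R\<close> then clears row \<open>i\<close> to the right of it.\<close>
  define L where "L = mat n n (\<lambda>(a, c). if a = c then 1 else
      if c = i \<and> a < i then - (y $$ (a, k) / y $$ (i, k)) else 0)"
  define z where "z = L * y"
  define R where "R = mat n n (\<lambda>(c, a). if c = a then 1 else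
      if c = k \<and> k < a then - (z $$ (i, a) / z $$ (i, k)) else 0)"
  have L: "L \<in> borel_subgroup n" and R: "R \<in> borel_subgroup n"
    by (auto simp: borel_subgroup_iff L_def R_def)
  have zM: "z \<in> carrier_mat n n" using yM unfolding z_def by (rule mult_carrier_mat[rotated]) (simp add: L_def)
  have z: "z $$ (a, c) = y $$ (a, c) - (if a < i then y $$ (a, k) / y $$ (i, k) * y $$ (i, c) else 0)"
    if "a < n" "c < n" for a c
  proof -
    have "z $$ (a, c) = (\<Sum>m<n. (if m = a then y $$ (a, c) else 0)
        + (if m = i then if a < i then - (y $$ (a, k) / y $$ (i, k)) * y $$ (i, c) else 0 else 0))"
      unfolding z_def index_mult_mat_sum[OF borel_subgroup_GL[OF L, THEN GL_carrier_mat] yM that]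
      using that by (intro sum.cong) (auto simp: L_def)
    also have "\<dots> = y $$ (a, c) + (if a < i then - (y $$ (a, k) / y $$ (i, k)) * y $$ (i, c) else 0)"
      unfolding sum.distrib using that i by simp
    finally show ?thesis by simp
  qed
  have zk: "z $$ (a, k) = (if a = i then y $$ (i, k) else 0)" if "a < n" for a
    using that k i below[of a] by (auto simp: z)
  have zR: "(z * R) $$ (a, c) = z $$ (a, c) - (if k < c then z $$ (a, k) * (z $$ (i, c) / z $$ (i, k)) else 0)"
    if "a < n" "c < n" for a c
  proof -
    have "(z * R) $$ (a, c) = (\<Sum>m<n. (if m = c then z $$ (a, c) else 0)
        + (if m = k then if k < c then - (z $$ (a, k) * (z $$ (i, c) / z $$ (i, k))) else 0 else 0))"
      unfolding index_mult_mat_sum[OF zM borel_subgroup_GL[OF R, THEN GL_carrier_mat] that]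
      using that by (intro sum.cong) (auto simp: R_def)
    also have "\<dots> = z $$ (a, c) + (if k < c then - (z $$ (a, k) * (z $$ (i, c) / z $$ (i, k))) else 0)"
      unfolding sum.distrib using that k by simp
    finally show ?thesis by simp
  qed
  have new: "(z * R) $$ (a, c) = (if a = i then if c = k then y $$ (i, k) else 0
      else if c = k then 0 else z $$ (a, c))" if "a < n" "c < n" for a c
    using that k i ir(2)[of c] below[of a] by (cases "i < a") (auto simp: zR zk z)
  have old: "z $$ (a, j) = y $$ (a, j)" if "a < n" "j < k" for a j
    using that k ir(2)[of j] by (auto simp: z)
  have old_row: "z $$ (r j, c) = y $$ (r j, c)" if "c < n" "j < k" for c j
    using that k r[of j] by (auto simp: z cleared_column_def)
  have "\<exists>s. cleared_column n (z * R) j s" if "j < Suc k" for j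
  proof (cases "j = k")
    case True
    have "cleared_column n (z * R) k i"
      using i k by (auto simp: cleared_column_def new)
    then show ?thesis using True by blast
  next
    case False
    then have jk: "j < k" using that by simp
    then have "cleared_column n (z * R) j (r j)"
      using r[of j] k ir[of j] by (auto simp: cleared_column_def new old old_row)
    then show ?thesis by blast
  qed
  moreover have "z * R = (L * b) * x * (b' * R)"
    unfolding z_def y using L R b x by (simp add: borel_subgroup_GL GL.m_assoc[where n = n])
  ultimately show ?case
    using L R b by (intro exI[of _ "z * R"] bexI[of _ "L * b"] bexI[of _ "b' * R"]) auto
qed

text \<open>
  With all columns cleared the matrix is monomial, that is, a permutation matrix times a diagonal
  matrix, and the latter belongs to \<open>B\<close>.
\<close>

lemma GL_in_double_coset:
  fixes x :: "'a::{field,finite} mat"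
  assumes x: "x \<in> carrier (GL n)"
  obtains w where "w \<in> weyl_group n" "x \<in> double_coset n w"
proof -
  obtain y b b' where y: "y = b * x * b'" and b: "b \<in> borel_subgroup n" "b' \<in> borel_subgroup n"
    and "\<forall>j<n. \<exists>r. cleared_column n y j r" using clear_columns[OF x, of n] by auto
  then obtain r where r: "\<And>j. j < n \<Longrightarrow> cleared_column n y j (r j)" by metis
  have yM: "y \<in> carrier_mat n n" using y b x by (simp add: borel_subgroup_GL GL_carrier_mat)
  define p where "p j = (if j < n then r j else j)" for j
  have inj: "inj_on p {..<n}"
  proof (rule inj_onI)
    fix j j' assume "j \<in> {..<n}" "j' \<in> {..<n}" "p j = p j'"
    then have "j < n" "j' < n" "r j = r j'" by (auto simp: p_def)
    then show "j = j'" using r[of j] r[of j'] unfolding cleared_column_def by metis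
  qed
  moreover have "p ` {..<n} \<subseteq> {..<n}" using r by (auto simp: p_def cleared_column_def)
  ultimately have "p ` {..<n} = {..<n}" by (intro endo_inj_surj) auto
  with inj have p: "p permutes {..<n}" by (intro bij_imp_permutes) (auto simp: bij_betw_def p_def)
  define D where "D = mat n n (\<lambda>(i, j). if i = j then y $$ (r j, j) else 0)"
  have D: "D \<in> borel_subgroup n" using r by (auto simp: borel_subgroup_iff D_def cleared_column_def)
  have "perm_mat n p * D = y"
  proof (rule eq_matI)
    fix i j assume "i < dim_row y" "j < dim_col y"
    then have ij: "i < n" "j < n" using yM by auto
    have "Hilbert_Choice.inv p i < n" using permutes_in_image[OF permutes_inv[OF p], of i] ij by simp
    moreover have "Hilbert_Choice.inv p i = j \<longleftrightarrow> r j = i"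
      using permutes_inv_eq[OF p, of i j] ij by (simp add: p_def)
    ultimately show "(perm_mat n p * D) $$ (i, j) = y $$ (i, j)"
      using ij r[of j] p by (subst index_perm_mat_mult) (auto simp: D_def cleared_column_def)
  qed (use yM in \<open>simp_all add: perm_mat_def D_def\<close>)
  moreover have "x = inv\<^bsub>GL n\<^esub> b * y * inv\<^bsub>GL n\<^esub> b'"
    unfolding y using x b by (simp add: borel_subgroup_GL GL.word_simps[where n = n])
  ultimately have "x = inv\<^bsub>GL n\<^esub> b * perm_mat n p * (D * inv\<^bsub>GL n\<^esub> b')"
    using b D p by (auto simp: borel_subgroup_GL GL.word_simps[where n = n] perm_mat_GL)
  then have "x \<in> double_coset n (perm_mat n p)"
    using b D unfolding double_coset_def by blast
  then show thesis using that p by (auto simp: weyl_group_def)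
qed


section \<open>The size of a Bruhat cell\<close>

text \<open>
  This is \<open>B \<inter> x B x\<^sup>-\<^sup>1\<close>, the stabilizer in \<open>B\<close> of the flag \<open>x B\<close>.
\<close>

definition borel_stabilizer :: "nat \<Rightarrow> 'a::field mat \<Rightarrow> 'a mat set" where
  "borel_stabilizer n x = {d \<in> borel_subgroup n. inv\<^bsub>GL n\<^esub> x * d * x \<in> borel_subgroup n}"

lemma card_double_coset_Int:
  fixes x :: "'a::{field,finite} mat"
  assumes "x \<in> carrier (GL n)"
  shows "card {(b, b') \<in> borel_subgroup n \<times> borel_subgroup n. b * x * b' \<in> S} =
           card (borel_stabilizer n x) * card (S \<inter> double_coset n x)"
  using GL.card_double_coset_preimage[OF subgroup_borel finite_borel_subgroup assms, of S]
  by (simp add: borel_stabilizer_def double_coset_def)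

lemma card_double_coset_mult:
  fixes x :: "'a::{field,finite} mat"
  assumes "x \<in> carrier (GL n)"
  shows "card (borel_stabilizer n x) * card (double_coset n x) = card (borel_subgroup n :: 'a mat set) ^ 2"
  using card_double_coset_Int[OF assms, of UNIV]
  by (simp add: card_cartesian_product power2_eq_square)

lemma borel_stabilizer_perm_mat:
  assumes p: "p permutes {..<n}"
  shows "d \<in> borel_stabilizer n (perm_mat n p :: 'a::{field,finite} mat) \<longleftrightarrow>
           d \<in> borel_subgroup n \<and> (\<forall>i<n. \<forall>j<i. d $$ (p i, p j) = 0)"
proof (cases "d \<in> borel_subgroup n")
  case True
  let ?e = "perm_mat n (Hilbert_Choice.inv p) * d * perm_mat n p"
  have M: "d \<in> carrier_mat n n" using True by (simp add: borel_subgroup_iff)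
  have pn: "p i < n" if "i < n" for i using permutes_in_image[OF p, of i] that by simp
  have eM: "?e \<in> carrier_mat n n"
    by (rule mult_carrier_mat[OF mult_carrier_mat[OF perm_mat_carrier M] perm_mat_carrier])
  have e: "?e $$ (i, j) = d $$ (p i, p j)" if "i < n" "j < n" for i j
  proof -
    have "perm_mat n (Hilbert_Choice.inv p) * d \<in> carrier_mat n n"
      using M by (rule mult_carrier_mat[OF perm_mat_carrier])
    then have "?e $$ (i, j) = (perm_mat n (Hilbert_Choice.inv p) * d) $$ (i, p j)"
      by (rule index_mult_perm_mat[OF p _ that])
    also have "\<dots> = d $$ (p i, p j)"
      using index_perm_mat_mult[OF permutes_inv[OF p] M that(1) pn[OF that(2)]]
      by (simp only: permutes_inv_inv[OF p])
    finally show ?thesis .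
  qed
  then show ?thesis
    using True pn eM unfolding borel_stabilizer_def inv_perm_mat[OF p] borel_subgroup_iff by (auto simp: e)
qed (simp add: borel_stabilizer_def)

text \<open>
  Passing from \<open>p\<close> to \<open>p s\<^sub>i\<close> across an ascent \<open>p i < p (i + 1)\<close> adds to the linear conditions that cut out
  \<open>B \<inter> p B p\<^sup>-\<^sup>1\<close> the vanishing of one more entry above the diagonal, which was free before.
\<close>

lemma card_borel_stabilizer_ascent:
  assumes p: "p permutes {..<n}" and i: "Suc i < n" "p i < p (Suc i)"
  shows "card (borel_stabilizer n (perm_mat n p :: 'a::{field,finite} mat)) =
    card (UNIV :: 'a set) *
      card (borel_stabilizer n (perm_mat n (p \<circ> Transposition.transpose i (Suc i)) :: 'a mat))"
proof -
  let ?s = "Transposition.transpose i (Suc i)"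
  have s: "?s permutes {..<n}" using i by (intro permutes_swap_id) auto
  have ps: "p \<circ> ?s permutes {..<n}" by (rule permutes_compose[OF s p])
  have pn: "p i < n" "p (Suc i) < n"
    using permutes_in_image[OF p, of i] permutes_in_image[OF p, of "Suc i"] i by auto
  let ?D = "borel_stabilizer n (perm_mat n p) :: 'a mat set"
  let ?E = "borel_stabilizer n (perm_mat n (p \<circ> ?s)) :: 'a mat set"
  have E: "d \<in> ?E \<longleftrightarrow> d \<in> ?D \<and> d $$ (p i, p (Suc i)) = 0" for d :: "'a mat"
  proof (cases "d \<in> borel_subgroup n")
    case True
    then have lower: "d $$ (p (Suc i), p i) = 0" using i pn by (simp add: borel_subgroup_iff)
    have s_less: "?s b < ?s a \<longleftrightarrow> (if a = i \<and> b = Suc i then True else if a = Suc i \<and> b = i then False else b < a)"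
      for a b by (auto simp: Transposition.transpose_def)
    have "(\<forall>k<n. \<forall>j<k. d $$ (p (?s k), p (?s j)) = 0) \<longleftrightarrow>
        (\<forall>a<n. \<forall>b<n. ?s b < ?s a \<longrightarrow> d $$ (p a, p b) = 0)"
    proof safe
      fix a b assume *: "\<forall>k<n. \<forall>j<k. d $$ (p (?s k), p (?s j)) = 0" and "a < n" "b < n" "?s b < ?s a"
      moreover have "?s a < n" using permutes_in_image[OF s, of a] \<open>a < n\<close> by simp
      ultimately show "d $$ (p a, p b) = 0" using *[rule_format, of "?s a" "?s b"] by simp
    next
      fix k j assume *: "\<forall>a<n. \<forall>b<n. ?s b < ?s a \<longrightarrow> d $$ (p a, p b) = 0" and "k < n" "j < k"
      moreover have "?s k < n" "?s j < n"
        using permutes_in_image[OF s, of k] permutes_in_image[OF s, of j] \<open>k < n\<close> \<open>j < k\<close> by auto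
      ultimately show "d $$ (p (?s k), p (?s j)) = 0" by simp
    qed
    also have "\<dots> \<longleftrightarrow> (\<forall>k<n. \<forall>j<k. d $$ (p k, p j) = 0) \<and> d $$ (p i, p (Suc i)) = 0"
    proof (intro iffI conjI allI impI)
      fix k j assume *: "\<forall>a<n. \<forall>b<n. ?s b < ?s a \<longrightarrow> d $$ (p a, p b) = 0" and "k < n" "j < k"
      then show "d $$ (p k, p j) = 0"
        using lower *[rule_format, of k j] by (cases "k = Suc i \<and> j = i") (auto simp: s_less)
    next
      assume *: "\<forall>a<n. \<forall>b<n. ?s b < ?s a \<longrightarrow> d $$ (p a, p b) = 0"
      show "d $$ (p i, p (Suc i)) = 0"
        using *[rule_format, of i "Suc i"] i by (simp add: s_less)
    next
      fix a b assume *: "(\<forall>k<n. \<forall>j<k. d $$ (p k, p j) = 0) \<and> d $$ (p i, p (Suc i)) = 0"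
        and "a < n" "b < n" "?s b < ?s a"
      then show "d $$ (p a, p b) = 0"
        unfolding s_less by (cases "a = i \<and> b = Suc i") (auto split: if_splits)
    qed
    finally show ?thesis
      by (simp add: borel_stabilizer_perm_mat[OF p] borel_stabilizer_perm_mat[OF ps])
  qed (simp add: borel_stabilizer_def)
  define set_entry where "set_entry d c =
      mat n n (\<lambda>ab. if ab = (p i, p (Suc i)) then c else d $$ ab)" for d :: "'a mat" and c
  have set_entry: "set_entry d c \<in> ?D" if "d \<in> ?D" for d c
  proof -
    have "\<not> (p a = p i \<and> p b = p (Suc i))" if "b < a" for a b
      using that inj_eq[OF permutes_inj[OF p]] by auto
    then show ?thesis
      using that i pn permutes_in_image[OF p]
      by (auto simp: borel_stabilizer_perm_mat[OF p] borel_subgroup_iff set_entry_def)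
  qed
  have DM: "d \<in> carrier_mat n n" if "d \<in> ?D" for d
    using that by (simp add: borel_stabilizer_def borel_subgroup_iff)
  have twice: "set_entry (set_entry d c') c = set_entry d c" for d c c'
    by (rule eq_matI) (auto simp: set_entry_def)
  have same: "set_entry d c = d" if "d \<in> ?D" "d $$ (p i, p (Suc i)) = c" for d c
    using DM[OF that(1)] that(2) by (intro eq_matI) (auto simp: set_entry_def)
  have entry: "set_entry d c $$ (p i, p (Suc i)) = c" for d c
    using pn by (simp add: set_entry_def)
  have "bij_betw (\<lambda>(d, c). set_entry d c) (?E \<times> UNIV) ?D"
  proof (rule bij_betw_byWitness[where f' = "\<lambda>d. (set_entry d 0, d $$ (p i, p (Suc i)))"])
    show "\<forall>dc \<in> ?E \<times> UNIV. (\<lambda>d. (set_entry d 0, d $$ (p i, p (Suc i)))) ((\<lambda>(d, c). set_entry d c) dc) = dc"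
      by (auto simp: twice same entry E)
    show "\<forall>d \<in> ?D. (\<lambda>(d, c). set_entry d c) (set_entry d 0, d $$ (p i, p (Suc i))) = d"
      by (simp add: twice same)
    show "(\<lambda>(d, c). set_entry d c) ` (?E \<times> UNIV) \<subseteq> ?D"
      using set_entry by (auto simp: E)
    show "(\<lambda>d. (set_entry d 0, d $$ (p i, p (Suc i)))) ` ?D \<subseteq> ?E \<times> UNIV"
      using set_entry by (auto simp: E entry)
  qed
  then have "card (?E \<times> (UNIV :: 'a set)) = card ?D" by (rule bij_betw_same_card)
  then show ?thesis by (simp add: card_cartesian_product mult.commute)
qed

lemma card_double_coset_ascent:
  assumes p: "p permutes {..<n}" and i: "Suc i < n" "p i < p (Suc i)"
  shows "card (double_coset n (perm_mat n (p \<circ> Transposition.transpose i (Suc i)) :: 'a::{field,finite} mat)) =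
    card (UNIV :: 'a set) * card (double_coset n (perm_mat n p :: 'a mat))"
proof -
  let ?q = "p \<circ> Transposition.transpose i (Suc i)"
  let ?D = "\<lambda>p. card (borel_stabilizer n (perm_mat n p :: 'a mat))"
  let ?N = "\<lambda>p. card (double_coset n (perm_mat n p :: 'a mat))"
  have q: "?q permutes {..<n}"
    using i by (intro permutes_compose[OF permutes_swap_id p]) auto
  have "?D p * ?N p = ?D ?q * ?N ?q"
    using card_double_coset_mult[OF perm_mat_GL[OF p, where 'a = 'a]]
      card_double_coset_mult[OF perm_mat_GL[OF q, where 'a = 'a]] by simp
  moreover have "?D ?q > 0"
    using card_double_coset_mult[OF perm_mat_GL[OF q, where 'a = 'a]] card_borel_pos[of n, where 'a = 'a]
    by (intro Nat.gr0I) simp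
  ultimately show ?thesis
    using card_borel_stabilizer_ascent[OF p i, where 'a = 'a] by simp
qed

lemma foldr_mult_GL_closed:
  fixes z :: "'a::field mat"
  assumes "set ss \<subseteq> carrier (GL n)" "z \<in> carrier (GL n)"
  shows "foldr (*) ss z \<in> carrier (GL n)"
  using assms by (induction ss) auto

lemma foldr_mult_GL:
  fixes z :: "'a::field mat"
  assumes "set ss \<subseteq> carrier (GL n)" "z \<in> carrier (GL n)"
  shows "foldr (*) ss z = foldr (*) ss (1\<^sub>m n) * z"
  using assms
proof (induction ss)
  case (Cons s ss)
  then have "foldr (*) ss (1\<^sub>m n) \<in> carrier (GL n)" by (intro foldr_mult_GL_closed) auto
  with Cons show ?case by (simp add: GL.m_assoc[where n = n])
qed simp

lemma simple_reflections_weyl_group: "simple_reflections n \<subseteq> weyl_group n"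
  unfolding simple_reflections_def weyl_group_def by (auto intro!: imageI permutes_swap_id)

lemma card_double_coset_swap:
  fixes n i :: nat and p :: "nat \<Rightarrow> nat"
  defines "t \<equiv> Transposition.transpose i (Suc i)"
    and "N \<equiv> \<lambda>p. card (double_coset n (perm_mat n p :: 'a::{field,finite} mat))"
  assumes p: "p permutes {..<n}" and i: "Suc i < n"
  shows "p \<circ> t permutes {..<n}"
    and "p i < p (Suc i) \<Longrightarrow> N (p \<circ> t) = card (UNIV :: 'a set) * N p"
    and "p i > p (Suc i) \<Longrightarrow> N p = card (UNIV :: 'a set) * N (p \<circ> t)"
proof -
  show pt: "p \<circ> t permutes {..<n}"
    unfolding t_def using i by (intro permutes_compose[OF permutes_swap_id p]) auto
  show "p i < p (Suc i) \<Longrightarrow> N (p \<circ> t) = card (UNIV :: 'a set) * N p"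
    unfolding N_def t_def by (rule card_double_coset_ascent[OF p i])
  have ptt: "p \<circ> t \<circ> t = p" by (simp add: t_def comp_assoc)
  show "p i > p (Suc i) \<Longrightarrow> N p = card (UNIV :: 'a set) * N (p \<circ> t)"
    using card_double_coset_ascent[OF pt i, where 'a = 'a] ptt unfolding N_def t_def by simp
qed

lemma double_coset_one: "double_coset n (1\<^sub>m n) = (borel_subgroup n :: 'a::{field,finite} mat set)"
proof (intro equalityI subsetI)
  fix x :: "'a mat" assume "x \<in> double_coset n (1\<^sub>m n)"
  then obtain b b' where "b \<in> borel_subgroup n" "b' \<in> borel_subgroup n" "x = b * 1\<^sub>m n * b'"
    unfolding double_coset_def by blast
  then show "x \<in> borel_subgroup n" by (simp add: borel_subgroup_GL)
next
  fix x :: "'a mat" assume "x \<in> borel_subgroup n"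
  then have "x = x * 1\<^sub>m n * 1\<^sub>m n" by (simp add: borel_subgroup_GL)
  then show "x \<in> double_coset n (1\<^sub>m n)"
    using \<open>x \<in> _\<close> borel.one_closed unfolding double_coset_def by blast
qed

lemma card_field_ge_2: "card (UNIV :: 'a::{field,finite} set) \<ge> 2"
proof -
  have "card {0, 1 :: 'a} \<le> card (UNIV :: 'a set)" by (intro card_mono) auto
  then show ?thesis by simp
qed

lemma simple_reflection_word_bound:
  fixes ss :: "'a::{field,finite} mat list"
  assumes "set ss \<subseteq> simple_reflections n"
  shows "\<exists>p. p permutes {..<n} \<and> foldr (*) ss (1\<^sub>m n) = perm_mat n p \<and>
    card (double_coset n (perm_mat n p :: 'a mat)) \<le>
      card (borel_subgroup n :: 'a mat set) * card (UNIV :: 'a set) ^ length ss"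
  using assms
proof (induction ss rule: rev_induct)
  case Nil
  show ?case by (intro exI[of _ id] conjI permutes_id) (simp_all only: perm_mat_id double_coset_one, simp_all)
next
  case (snoc s ss)
  let ?q = "card (UNIV :: 'a set)"
  let ?N = "\<lambda>p. card (double_coset n (perm_mat n p :: 'a mat))"
  from snoc obtain p where p: "p permutes {..<n}" "foldr (*) ss (1\<^sub>m n) = perm_mat n p"
    and le: "?N p \<le> card (borel_subgroup n :: 'a mat set) * ?q ^ length ss" by auto
  from snoc.prems obtain i where i: "Suc i < n" "s = perm_mat n (Transposition.transpose i (Suc i))"
    by (auto simp: simple_reflections_def)
  let ?t = "Transposition.transpose i (Suc i)"
  note swap1 = card_double_coset_swap(1)[OF p(1) i(1)]
    and swap = card_double_coset_swap(2,3)[OF p(1) i(1), where 'a = 'a]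
  have ss: "set ss \<subseteq> carrier (GL n)" "s \<in> carrier (GL n)"
    using snoc.prems simple_reflections_weyl_group weyl_group_GL by fastforce+
  have "foldr (*) (ss @ [s]) (1\<^sub>m n) = perm_mat n p * s"
    using foldr_mult_GL[OF ss] ss p(2) by simp
  also have "\<dots> = perm_mat n (p \<circ> ?t)"
    unfolding i(2) using p i by (intro perm_mat_mult permutes_swap_id) auto
  finally have word: "foldr (*) (ss @ [s]) (1\<^sub>m n) = perm_mat n (p \<circ> ?t)" .
  have "p i \<noteq> p (Suc i)" using inj_eq[OF permutes_inj[OF p(1)]] by simp
  then have "?N (p \<circ> ?t) \<le> ?q * ?N p"
    using swap card_field_ge_2[where 'a = 'a] by (cases "p i < p (Suc i)") auto
  also have "\<dots> \<le> card (borel_subgroup n :: 'a mat set) * ?q ^ length (ss @ [s])"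
    using le by simp
  finally show ?case using word swap1 by blast
qed

text \<open>
  Cancelling a descent \<open>p (i + 1) < p i\<close> on the right divides the size of the cell by \<open>q\<close>, so the
  process stops, and it stops at the identity.
\<close>

lemma simple_reflection_word_exists:
  assumes "p permutes {..<n}"
  shows "\<exists>ss :: 'a mat list. set ss \<subseteq> simple_reflections n \<and> foldr (*) ss (1\<^sub>m n) = perm_mat n p \<and>
    card (double_coset n (perm_mat n p :: 'a::{field,finite} mat)) =
      card (borel_subgroup n :: 'a mat set) * card (UNIV :: 'a set) ^ length ss"
  using assms
proof (induction "card (double_coset n (perm_mat n p :: 'a mat))" arbitrary: p rule: less_induct)
  case less
  let ?q = "card (UNIV :: 'a set)"
  let ?N = "\<lambda>p. card (double_coset n (perm_mat n p :: 'a mat))"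
  note p = \<open>p permutes {..<n}\<close>
  show ?case
  proof (cases "\<exists>i. Suc i < n \<and> p (Suc i) < p i")
    case True
    then obtain i where i: "Suc i < n" "p (Suc i) < p i" by auto
    let ?t = "Transposition.transpose i (Suc i)"
    note swap1 = card_double_coset_swap(1)[OF p i(1)]
    and swap = card_double_coset_swap(2,3)[OF p i(1), where 'a = 'a]
    have "finite (double_coset n (perm_mat n p :: 'a mat))"
      using finite_GL double_coset_subset_GL[OF perm_mat_GL[OF p]] by (rule finite_subset[rotated])
    then have "?N p > 0"
      using self_in_double_coset[OF perm_mat_GL[OF p]] by (metis card_gt_0_iff empty_iff)
    then have "?N (p \<circ> ?t) < ?N p"
      using swap(2)[OF i(2)] card_field_ge_2[where 'a = 'a] by (cases "?N (p \<circ> ?t) = 0") auto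
    from less.hyps[OF this swap1] obtain ss :: "'a mat list" where
      ss: "set ss \<subseteq> simple_reflections n" "foldr (*) ss (1\<^sub>m n) = perm_mat n (p \<circ> ?t)"
        "?N (p \<circ> ?t) = card (borel_subgroup n :: 'a mat set) * ?q ^ length ss" by blast
    let ?s = "perm_mat n ?t :: 'a mat"
    have t: "?t permutes {..<n}" using i by (intro permutes_swap_id) auto
    have s: "?s \<in> simple_reflections n" using i by (auto simp: simple_reflections_def)
    have "foldr (*) (ss @ [?s]) (1\<^sub>m n) = perm_mat n (p \<circ> ?t) * ?s"
      using foldr_mult_GL[of ss n ?s] ss simple_reflections_weyl_group[of n, where 'a = 'a]
        weyl_group_GL[where n = n and 'a = 'a] perm_mat_GL[OF t, where 'a = 'a] by auto
    also have "\<dots> = perm_mat n p"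
      using perm_mat_mult[OF swap1 t, where 'a = 'a] by (simp add: comp_assoc)
    finally have "foldr (*) (ss @ [?s]) (1\<^sub>m n) = perm_mat n p" .
    moreover have "?N p = card (borel_subgroup n :: 'a mat set) * ?q ^ length (ss @ [?s])"
      using swap(2)[OF i(2)] ss(3) by simp
    ultimately show ?thesis using ss(1) s by (intro exI[of _ "ss @ [?s]"]) auto
  next
    case False
    \<comment> \<open>Without descents \<open>p\<close> is increasing, hence the identity.\<close>
    have "i \<le> p i" if "i < n" for i
      using that
    proof (induction i)
      case (Suc i)
      then have "p i < p (Suc i)"
        using False inj_eq[OF permutes_inj[OF p], of i "Suc i"] by (metis linorder_neqE_nat n_not_Suc_n)
      then show ?case using Suc by simp
    qed simp
    then have "p = id" using p by (intro permutes_natset_ge[OF p]) auto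
    then show ?thesis by (intro exI[of _ "[]"]) (simp add: perm_mat_id double_coset_one)
  qed
qed

text \<open>
  The length of \<open>w\<close> is read off \<open>|BwB|\<close>: one letter changes the size of the cell by a factor
  \<open>q\<close> or \<open>1 / q\<close>, which bounds \<open>|BwB|\<close> by \<open>|B| q\<^sup>k\<close> for every word of length \<open>k\<close>, and removing
  descents one at a time produces a word for which this bound is attained.
\<close>

theorem card_double_coset:
  fixes w :: "'a::{field,finite} mat"
  assumes "w \<in> weyl_group n"
  shows "card (double_coset n w) =
    card (borel_subgroup n :: 'a mat set) * card (UNIV :: 'a set) ^ weyl_length n w"
proof -
  let ?q = "card (UNIV :: 'a set)"
  obtain p where p: "p permutes {..<n}" "w = perm_mat n p" using assms by (auto simp: weyl_group_def)
  obtain ss :: "'a mat list" where ss: "set ss \<subseteq> simple_reflections n" "foldr (*) ss (1\<^sub>m n) = w"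
    "card (double_coset n w) = card (borel_subgroup n :: 'a mat set) * ?q ^ length ss"
    using simple_reflection_word_exists[OF p(1), where 'a = 'a] p(2) by blast
  have "weyl_length n w = length ss"
    unfolding weyl_length_def
  proof (rule Least_equality)
    fix k assume "\<exists>ss. length ss = k \<and> set ss \<subseteq> simple_reflections n \<and> foldr (*) ss (1\<^sub>m n) = w"
    then obtain ss' :: "'a mat list" where ss': "length ss' = k" "set ss' \<subseteq> simple_reflections n"
      "foldr (*) ss' (1\<^sub>m n) = w" by blast
    then have "card (double_coset n w) \<le> card (borel_subgroup n :: 'a mat set) * ?q ^ k"
      using simple_reflection_word_bound[OF ss'(2)] by auto
    then have "?q ^ length ss \<le> ?q ^ k"
      using ss(3) card_borel_pos[of n, where 'a = 'a] by simp
    then show "length ss \<le> k"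
      using card_field_ge_2[where 'a = 'a] by (simp add: power_increasing_iff)
  qed (use ss in blast)
  then show ?thesis using ss(3) by simp
qed

text \<open>
  Inversion carries \<open>B w B\<close> onto \<open>B w\<^sup>-\<^sup>1 B\<close>, and the length is determined by the size of the cell.
\<close>

lemma weyl_length_inv:
  fixes w :: "'a::{field,finite} mat"
  assumes "w \<in> weyl_group n"
  shows "weyl_length n (inv\<^bsub>GL n\<^esub> w) = weyl_length n w"
proof -
  note wG = weyl_group_GL[OF assms]
  have "bij_betw (m_inv (GL n)) (double_coset n w) (double_coset n (inv\<^bsub>GL n\<^esub> w))"
    using wG double_coset_subset_GL[OF wG] double_coset_subset_GL[OF GL.inv_closed[OF wG]]
      inv_double_coset_iff[OF wG] inv_double_coset_iff[OF GL.inv_closed[OF wG]]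
    by (intro bij_betw_byWitness[where f' = "m_inv (GL n)"]) (auto simp: subset_iff)
  from bij_betw_same_card[OF this] show ?thesis
    using card_field_ge_2[where 'a = 'a] card_borel_pos[of n, where 'a = 'a]
    by (simp add: card_double_coset assms weyl_group_inv power_inject_exp)
qed


section \<open>Convolution\<close>

lemma galg_mult_outside: "x \<notin> carrier (GL n) \<Longrightarrow> galg_mult n f h x = 0"
  unfolding galg_mult_def by (rule sum.neutral) auto

lemma galg_mult_left:
  fixes f h :: "'a::{field,finite} mat \<Rightarrow> complex"
  assumes x: "x \<in> carrier (GL n)"
  shows "galg_mult n f h x = (\<Sum>y\<in>carrier (GL n). f y * h (inv\<^bsub>GL n\<^esub> y * x))"
  unfolding galg_mult_def using x
  by (intro sum.reindex_bij_witness[of _ "\<lambda>y. (y, inv\<^bsub>GL n\<^esub> y * x)" fst]) auto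

lemma galg_mult_right:
  fixes f h :: "'a::{field,finite} mat \<Rightarrow> complex"
  assumes x: "x \<in> carrier (GL n)"
  shows "galg_mult n f h x = (\<Sum>z\<in>carrier (GL n). f (x * inv\<^bsub>GL n\<^esub> z) * h z)"
  unfolding galg_mult_left[OF x] using x
  by (intro sum.reindex_bij_witness[of _ "\<lambda>z. x * inv\<^bsub>GL n\<^esub> z" "\<lambda>y. inv\<^bsub>GL n\<^esub> y * x"])
     (auto simp: GL.word_simps[where n = n])

lemma galg_mult_assoc: "galg_mult n (galg_mult n f h) k = galg_mult n f (galg_mult n h k)"
proof
  fix x
  let ?G = "carrier (GL n)"
  show "galg_mult n (galg_mult n f h) k x = galg_mult n f (galg_mult n h k) x"
  proof (cases "x \<in> ?G")
    case True
    have "galg_mult n (galg_mult n f h) k x =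
        (\<Sum>z\<in>?G. \<Sum>y\<in>?G. f y * h (inv\<^bsub>GL n\<^esub> y * (x * inv\<^bsub>GL n\<^esub> z)) * k z)"
      using True by (simp add: galg_mult_right[OF True, of "galg_mult n f h"] galg_mult_left sum_distrib_right)
    also have "\<dots> = (\<Sum>y\<in>?G. \<Sum>z\<in>?G. f y * (h (inv\<^bsub>GL n\<^esub> y * x * inv\<^bsub>GL n\<^esub> z) * k z))"
      using True by (subst sum.swap) (simp add: GL.m_assoc[where n = n] mult.assoc)
    also have "\<dots> = galg_mult n f (galg_mult n h k) x"
      using True by (simp add: galg_mult_left[OF True, of f] galg_mult_right sum_distrib_left)
    finally show ?thesis .
  qed (simp add: galg_mult_outside)
qed

lemma galg_mult_add_left: "galg_mult n (f + f') h = galg_mult n f h + galg_mult n f' h"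
  by (auto simp: galg_mult_def fun_eq_iff case_prod_unfold algebra_simps sum.distrib)

lemma galg_mult_add_right: "galg_mult n f (h + h') = galg_mult n f h + galg_mult n f h'"
  by (auto simp: galg_mult_def fun_eq_iff case_prod_unfold algebra_simps sum.distrib)

lemma galg_mult_cscale_left: "galg_mult n (cscale c f) h = cscale c (galg_mult n f h)"
  by (auto simp: galg_mult_def cscale_def fun_eq_iff case_prod_unfold sum_distrib_left mult_ac)

lemma galg_mult_cscale_right: "galg_mult n f (cscale c h) = cscale c (galg_mult n f h)"
  by (auto simp: galg_mult_def cscale_def fun_eq_iff case_prod_unfold sum_distrib_left mult_ac)

lemma galg_mult_indicator:
  fixes g :: "'a::{field,finite} mat"
  assumes "g \<in> carrier (GL n)" "x \<in> carrier (GL n)"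
  shows "galg_mult n (indicator {g}) f x = f (inv\<^bsub>GL n\<^esub> g * x)"
proof -
  have "galg_mult n (indicator {g}) f x =
      (\<Sum>y\<in>carrier (GL n). if y = g then f (inv\<^bsub>GL n\<^esub> y * x) else 0)"
    unfolding galg_mult_left[OF assms(2)] by (intro sum.cong) (auto simp: indicator_def)
  then show ?thesis using assms by simp
qed

lemma sum_fun_apply: "(\<Sum>i\<in>I. F i) x = (\<Sum>i\<in>I. F i x)"
  by (induction I rule: infinite_finite_induct) auto

lemma class_function_central:
  fixes z f :: "'a::{field,finite} mat \<Rightarrow> complex"
  assumes "\<And>x y. x \<in> carrier (GL n) \<Longrightarrow> y \<in> carrier (GL n) \<Longrightarrow> z (x * y) = z (y * x)"
  shows "galg_mult n z f = galg_mult n f z"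
proof
  fix x
  show "galg_mult n z f x = galg_mult n f z x"
  proof (cases "x \<in> carrier (GL n)")
    case True
    then show ?thesis
      unfolding galg_mult_right[OF True, of z] galg_mult_left[OF True, of f]
      by (intro sum.cong) (simp_all add: assms)
  qed (simp add: galg_mult_outside)
qed


section \<open>The Borel idempotent and the functions that it fixes\<close>

lemma cscale_apply: "cscale c f x = c * f x"
  by (simp add: cscale_def)

lemma hecke_T_apply:
  fixes w x :: "'a::{field,finite} mat"
  shows "hecke_T n w x = (if x \<in> double_coset n w then 1 / of_nat (card (borel_subgroup n :: 'a mat set)) else 0)"
  by (simp add: hecke_T_def cscale_def indicator_def)

lemma flag_vector_eq:
  fixes g :: "'a::{field,finite} mat"
  assumes "g \<in> carrier (GL n)"
  shows "flag_vector n g = galg_mult n (indicator {g}) (hecke_T n (1\<^sub>m n))"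
proof
  fix x :: "'a mat"
  have coset: "x \<in> g <#\<^bsub>GL n\<^esub> borel_subgroup n \<longleftrightarrow>
      x \<in> carrier (GL n) \<and> inv\<^bsub>GL n\<^esub> g * x \<in> borel_subgroup n"
  proof
    assume "x \<in> g <#\<^bsub>GL n\<^esub> borel_subgroup n"
    then show "x \<in> carrier (GL n) \<and> inv\<^bsub>GL n\<^esub> g * x \<in> borel_subgroup n"
      using assms by (auto simp: l_coset_def mult_GL borel_subgroup_GL)
  next
    assume *: "x \<in> carrier (GL n) \<and> inv\<^bsub>GL n\<^esub> g * x \<in> borel_subgroup n"
    then have "x = g * (inv\<^bsub>GL n\<^esub> g * x)" using assms by simp
    then show "x \<in> g <#\<^bsub>GL n\<^esub> borel_subgroup n" using * unfolding l_coset_def mult_GL by blast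
  qed
  show "flag_vector n g x = galg_mult n (indicator {g}) (hecke_T n (1\<^sub>m n)) x"
  proof (cases "x \<in> carrier (GL n)")
    case True
    then show ?thesis
      using assms by (simp add: galg_mult_indicator hecke_T_apply double_coset_one flag_vector_def
          cscale_def indicator_def coset)
  qed (simp add: galg_mult_outside flag_vector_def cscale_def indicator_def coset)
qed

definition right_invariant :: "nat \<Rightarrow> ('a::{field,finite} mat \<Rightarrow> complex) \<Rightarrow> bool" where
  "right_invariant n f \<longleftrightarrow> (\<forall>x\<in>carrier (GL n). \<forall>b\<in>borel_subgroup n. f (x * b) = f x)"

definition left_invariant :: "nat \<Rightarrow> ('a::{field,finite} mat \<Rightarrow> complex) \<Rightarrow> bool" where
  "left_invariant n f \<longleftrightarrow> (\<forall>x\<in>carrier (GL n). \<forall>b\<in>borel_subgroup n. f (b * x) = f x)"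

text \<open>
  \<open>T\<^sub>1\<close> is the idempotent of \<open>\<complex>B\<close> attached to the trivial representation of \<open>B\<close>: multiplication by it
  averages over \<open>B\<close>.  So the flag representation \<open>\<complex>G T\<^sub>1\<close> consists of the right invariant functions,
  and the elements of \<open>H\<close> are invariant on both sides.
\<close>

lemma galg_mult_borel_right:
  fixes f :: "'a::{field,finite} mat \<Rightarrow> complex"
  assumes "x \<in> carrier (GL n)"
  shows "galg_mult n f (hecke_T n (1\<^sub>m n)) x =
    (\<Sum>b\<in>borel_subgroup n. f (x * b)) / of_nat (card (borel_subgroup n :: 'a mat set))"
proof -
  let ?B = "borel_subgroup n :: 'a mat set"
  have "galg_mult n f (hecke_T n (1\<^sub>m n)) x =
      (\<Sum>z\<in>carrier (GL n). if z \<in> ?B then f (x * inv\<^bsub>GL n\<^esub> z) / of_nat (card ?B) else 0)"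
    unfolding galg_mult_right[OF assms] by (intro sum.cong) (auto simp: hecke_T_apply double_coset_one)
  also have "\<dots> = (\<Sum>z\<in>?B. f (x * inv\<^bsub>GL n\<^esub> z) / of_nat (card ?B))"
    using borel_subgroup_GL
    by (subst sum.inter_restrict[symmetric]) (auto intro!: sum.cong)
  also have "\<dots> = (\<Sum>b\<in>?B. f (x * b) / of_nat (card ?B))"
    by (rule sum.reindex_bij_witness[of _ "m_inv (GL n)" "m_inv (GL n)"]) (auto simp: borel_subgroup_GL)
  finally show ?thesis by (simp add: sum_divide_distrib)
qed

lemma galg_mult_borel_left:
  fixes f :: "'a::{field,finite} mat \<Rightarrow> complex"
  assumes "x \<in> carrier (GL n)"
  shows "galg_mult n (hecke_T n (1\<^sub>m n)) f x =
    (\<Sum>b\<in>borel_subgroup n. f (b * x)) / of_nat (card (borel_subgroup n :: 'a mat set))"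
proof -
  let ?B = "borel_subgroup n :: 'a mat set"
  have "galg_mult n (hecke_T n (1\<^sub>m n)) f x =
      (\<Sum>z\<in>carrier (GL n). if z \<in> ?B then f (inv\<^bsub>GL n\<^esub> z * x) / of_nat (card ?B) else 0)"
    unfolding galg_mult_left[OF assms] by (intro sum.cong) (auto simp: hecke_T_apply double_coset_one)
  also have "\<dots> = (\<Sum>z\<in>?B. f (inv\<^bsub>GL n\<^esub> z * x) / of_nat (card ?B))"
    using borel_subgroup_GL
    by (subst sum.inter_restrict[symmetric]) (auto intro!: sum.cong)
  also have "\<dots> = (\<Sum>b\<in>?B. f (b * x) / of_nat (card ?B))"
    by (rule sum.reindex_bij_witness[of _ "m_inv (GL n)" "m_inv (GL n)"]) (auto simp: borel_subgroup_GL)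
  finally show ?thesis by (simp add: sum_divide_distrib)
qed

lemma right_invariant_fixed:
  assumes "right_invariant n f" "f \<in> group_algebra n"
  shows "galg_mult n f (hecke_T n (1\<^sub>m n)) = f"
proof
  fix x
  show "galg_mult n f (hecke_T n (1\<^sub>m n)) x = f x"
    using assms card_borel_pos[of n, where 'a = 'a]
    by (cases "x \<in> carrier (GL n)")
       (auto simp: galg_mult_borel_right right_invariant_def galg_mult_outside group_algebra_def)
qed

lemma left_invariant_fixed:
  assumes "left_invariant n f" "f \<in> group_algebra n"
  shows "galg_mult n (hecke_T n (1\<^sub>m n)) f = f"
proof
  fix x
  show "galg_mult n (hecke_T n (1\<^sub>m n)) f x = f x"
    using assms card_borel_pos[of n, where 'a = 'a]
    by (cases "x \<in> carrier (GL n)")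
       (auto simp: galg_mult_borel_left left_invariant_def galg_mult_outside group_algebra_def)
qed

lemma right_invariant_galg_mult:
  "right_invariant n h \<Longrightarrow> right_invariant n (galg_mult n f h)"
  unfolding right_invariant_def
  by (simp add: galg_mult_left borel_subgroup_GL GL.m_assoc[where n = n, symmetric])

lemma hecke_algebra_invariant:
  fixes h :: "'a::{field,finite} mat \<Rightarrow> complex"
  assumes "h \<in> hecke_algebra n"
  shows "h \<in> group_algebra n" "right_invariant n h" "left_invariant n h"
proof -
  let ?S = "{h. h \<in> group_algebra n \<and> right_invariant n h \<and> left_invariant n h} :: ('a mat \<Rightarrow> complex) set"
  have "cfun.subspace ?S"
    by (auto simp: cfun.subspace_def group_algebra_def right_invariant_def left_invariant_def cscale_def)
  moreover have "hecke_T n ` weyl_group n \<subseteq> ?S"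
    using double_coset_subset_GL[OF weyl_group_GL, where 'a = 'a, THEN subsetD]
    by (auto simp: hecke_T_apply group_algebra_def right_invariant_def left_invariant_def
        mult_double_coset_iff weyl_group_GL)
  ultimately have "hecke_algebra n \<subseteq> ?S"
    unfolding hecke_algebra_def by (rule cfun.span_minimal[rotated])
  then show "h \<in> group_algebra n" "right_invariant n h" "left_invariant n h" using assms by auto
qed

text \<open>
  The vectors \<open>v\<^sub>x\<close> are indexed here by all of \<open>G\<close>, so each of them occurs \<open>|B|\<close> times.  In exchange the
  coefficient of \<open>v\<^sub>x\<close> is simply the value at \<open>x\<close>, without a choice of representatives for \<open>G/B\<close>.
\<close>

lemma right_invariant_expansion:
  fixes f :: "'a::{field,finite} mat \<Rightarrow> complex"
  assumes "f \<in> group_algebra n" "right_invariant n f"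
  shows "f = (\<Sum>x\<in>carrier (GL n). cscale (f x) (flag_vector n x))"
proof
  fix y
  let ?E = "hecke_T n (1\<^sub>m n) :: 'a mat \<Rightarrow> complex"
  have "(\<Sum>x\<in>carrier (GL n). cscale (f x) (flag_vector n x)) y = galg_mult n f ?E y"
  proof (cases "y \<in> carrier (GL n)")
    case True
    then show ?thesis
      by (simp add: sum_fun_apply cscale_apply flag_vector_eq galg_mult_indicator galg_mult_left[OF True, of f])
  qed (simp add: sum_fun_apply cscale_apply flag_vector_eq galg_mult_outside)
  then show "f y = (\<Sum>x\<in>carrier (GL n). cscale (f x) (flag_vector n x)) y"
    using right_invariant_fixed[OF assms(2,1)] by simp
qed

lemma flag_rep_iff:
  fixes f :: "'a::{field,finite} mat \<Rightarrow> complex"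
  shows "f \<in> flag_rep n \<longleftrightarrow> f \<in> group_algebra n \<and> right_invariant n f"
proof
  let ?S = "{h. h \<in> group_algebra n \<and> right_invariant n h} :: ('a mat \<Rightarrow> complex) set"
  have E: "right_invariant n (hecke_T n (1\<^sub>m n) :: 'a mat \<Rightarrow> complex)"
    by (auto simp: right_invariant_def hecke_T_apply mult_double_coset_iff)
  have "cfun.subspace ?S"
    by (auto simp: cfun.subspace_def group_algebra_def right_invariant_def cscale_def)
  moreover have "flag_vector n ` carrier (GL n) \<subseteq> ?S"
    by (auto simp: flag_vector_eq group_algebra_def galg_mult_outside right_invariant_galg_mult E)
  ultimately have "flag_rep n \<subseteq> ?S"
    unfolding flag_rep_def by (rule cfun.span_minimal[rotated])
  then show "f \<in> flag_rep n \<Longrightarrow> f \<in> group_algebra n \<and> right_invariant n f" by auto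
next
  assume f: "f \<in> group_algebra n \<and> right_invariant n f"
  have "(\<Sum>x\<in>carrier (GL n). cscale (f x) (flag_vector n x)) \<in> flag_rep n"
    unfolding flag_rep_def by (intro cfun.span_sum cfun.span_scale cfun.span_base imageI)
  then show "f \<in> flag_rep n"
    using right_invariant_expansion[of f n] f by simp
qed

lemma hecke_sum_apply:
  fixes v :: "'a::{field,finite} mat"
  assumes "v \<in> weyl_group n" "x \<in> double_coset n v"
  shows "(\<Sum>w\<in>weyl_group n. cscale (c w) (hecke_T n w)) x =
    c v / of_nat (card (borel_subgroup n :: 'a mat set))"
proof -
  have "(\<Sum>w\<in>weyl_group n. cscale (c w) (hecke_T n w)) x =
      (\<Sum>w\<in>weyl_group n. if w = v then c w / of_nat (card (borel_subgroup n :: 'a mat set)) else 0)"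
    unfolding sum_fun_apply
  proof (intro sum.cong refl)
    fix w :: "'a mat" assume "w \<in> weyl_group n"
    then have "x \<in> double_coset n w \<longleftrightarrow> w = v"
      using assms weyl_group_double_coset_eq by blast
    then show "cscale (c w) (hecke_T n w) x =
        (if w = v then c w / of_nat (card (borel_subgroup n :: 'a mat set)) else 0)"
      by (simp add: cscale_apply hecke_T_apply)
  qed
  then show ?thesis using assms(1) by simp
qed


section \<open>Traces from frames\<close>

text \<open>
  Each vector \<open>b\<close> of a basis is expanded in the \<open>v i\<close> inside \<open>T b\<close>, and then the two summations are
  exchanged.  This allows linearly dependent families, such as the \<open>v\<^sub>x\<close> with \<open>x \<in> G\<close>.
\<close>

lemma trace_on_frame:
  fixes V :: "('b \<Rightarrow> complex) set" and \<phi> :: "'i \<Rightarrow> ('b \<Rightarrow> complex) \<Rightarrow> complex"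
  assumes V: "cfun.subspace V" and I: "finite I" and v: "\<And>i. i \<in> I \<Longrightarrow> v i \<in> V"
    and \<phi>_add: "\<And>i x y. i \<in> I \<Longrightarrow> x \<in> V \<Longrightarrow> y \<in> V \<Longrightarrow> \<phi> i (x + y) = \<phi> i x + \<phi> i y"
    and \<phi>_scale: "\<And>i c x. i \<in> I \<Longrightarrow> x \<in> V \<Longrightarrow> \<phi> i (cscale c x) = c * \<phi> i x"
    and expand: "\<And>x. x \<in> V \<Longrightarrow> x = (\<Sum>i\<in>I. cscale (\<phi> i x) (v i))"
    and T: "\<And>x. x \<in> V \<Longrightarrow> T x \<in> V"
    and T_add: "\<And>x y. x \<in> V \<Longrightarrow> y \<in> V \<Longrightarrow> T (x + y) = T x + T y"
    and T_scale: "\<And>c x. x \<in> V \<Longrightarrow> T (cscale c x) = cscale c (T x)"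
  shows "trace_on V T = (\<Sum>i\<in>I. \<phi> i (T (v i)))"
proof -
  have zero: "0 \<in> V" using V by (rule cfun.subspace_0)
  have T_sum: "T (\<Sum>j\<in>J. cscale (c j) (u j)) = (\<Sum>j\<in>J. cscale (c j) (T (u j)))"
    if "finite J" "\<And>j. j \<in> J \<Longrightarrow> u j \<in> V" for J :: "'i set" and c u
    using that
  proof (induction J)
    case empty
    have "T 0 = 0" using T_add[OF zero zero] by simp
    then show ?case unfolding sum.empty .
  next
    case (insert j J)
    have "cscale (c j) (u j) \<in> V" "(\<Sum>j\<in>J. cscale (c j) (u j)) \<in> V"
      using insert.prems V by (auto intro!: cfun.subspace_sum cfun.subspace_scale)
    then show ?case
      unfolding sum.insert[OF insert.hyps] using insert.IH insert.prems
      by (simp only: T_add T_scale insertI1 insertI2)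
  qed
  have \<phi>_sum: "\<phi> i (\<Sum>j\<in>J. cscale (c j) (u j)) = (\<Sum>j\<in>J. c j * \<phi> i (u j))"
    if "finite J" "\<And>j. j \<in> J \<Longrightarrow> u j \<in> V" "i \<in> I" for J :: "('b \<Rightarrow> complex) set" and c u i
    using that
  proof (induction J)
    case empty
    then have "\<phi> i 0 = 0" using \<phi>_add[OF _ zero zero, of i] by simp
    then show ?case unfolding sum.empty .
  next
    case (insert j J)
    have "cscale (c j) (u j) \<in> V" "(\<Sum>j\<in>J. cscale (c j) (u j)) \<in> V"
      using insert.prems V by (auto intro!: cfun.subspace_sum cfun.subspace_scale)
    then show ?case
      unfolding sum.insert[OF insert.hyps] using insert.IH insert.prems
      by (simp only: \<phi>_add \<phi>_scale insertI1 insertI2)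
  qed
  define \<B> where "\<B> = (SOME \<B>. cfun.independent \<B> \<and> cfun.span \<B> = V)"
  have "\<exists>\<B>. cfun.independent \<B> \<and> cfun.span \<B> = V"
    using cfun.basis_exists[of V] cfun.span_minimal[OF _ V] by (metis subset_antisym)
  then have \<B>: "cfun.independent \<B>" "cfun.span \<B> = V"
    using someI_ex[of "\<lambda>\<B>. cfun.independent \<B> \<and> cfun.span \<B> = V"] unfolding \<B>_def by blast+
  have \<B>V: "b \<in> V" if "b \<in> \<B>" for b using \<B>(2) that cfun.span_base by blast
  have "\<B> \<subseteq> cfun.span (v ` I)"
  proof
    fix b assume "b \<in> \<B>"
    then have "b = (\<Sum>i\<in>I. cscale (\<phi> i b) (v i))" using expand \<B>V by blast
    also have "\<dots> \<in> cfun.span (v ` I)" by (intro cfun.span_sum cfun.span_scale cfun.span_base imageI)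
    finally show "b \<in> cfun.span (v ` I)" .
  qed
  then have fin: "finite \<B>"
    using cfun.independent_span_bound[of "v ` I" \<B>] I \<B>(1) by simp
  let ?rep = "cfun.representation \<B>"
  have "trace_on V T = (\<Sum>b\<in>\<B>. ?rep (T b) b)"
    by (simp add: trace_on_def \<B>_def Let_def)
  also have "\<dots> = (\<Sum>b\<in>\<B>. \<Sum>i\<in>I. \<phi> i b * ?rep (T (v i)) b)"
  proof (intro sum.cong refl)
    fix b assume "b \<in> \<B>"
    then have "T b = T (\<Sum>i\<in>I. cscale (\<phi> i b) (v i))" using expand \<B>V by metis
    also have "\<dots> = (\<Sum>i\<in>I. cscale (\<phi> i b) (T (v i)))" using I v by (rule T_sum)
    finally have "T b = (\<Sum>i\<in>I. cscale (\<phi> i b) (T (v i)))" .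
    then show "?rep (T b) b = (\<Sum>i\<in>I. \<phi> i b * ?rep (T (v i)) b)"
      using \<B> T v V by (simp add: cfun.representation_sum cfun.representation_scale cfun.subspace_scale)
  qed
  also have "\<dots> = (\<Sum>i\<in>I. \<Sum>b\<in>\<B>. ?rep (T (v i)) b * \<phi> i b)"
    by (subst sum.swap) (simp add: mult.commute)
  also have "\<dots> = (\<Sum>i\<in>I. \<phi> i (T (v i)))"
  proof (intro sum.cong refl)
    fix i assume i: "i \<in> I"
    have "(\<Sum>b\<in>\<B>. cscale (?rep (T (v i)) b) b) = T (v i)"
      using \<B> fin T[OF v[OF i]] by (intro cfun.sum_representation_eq) auto
    moreover have "\<phi> i (\<Sum>b\<in>\<B>. cscale (?rep (T (v i)) b) b) = (\<Sum>b\<in>\<B>. ?rep (T (v i)) b * \<phi> i b)"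
      by (rule \<phi>_sum[OF fin \<B>V i])
    ultimately show "(\<Sum>b\<in>\<B>. ?rep (T (v i)) b * \<phi> i b) = \<phi> i (T (v i))" by simp
  qed
  finally show ?thesis .
qed


section \<open>The trace on the flag representation\<close>

lemma subspace_flag_rep: "cfun.subspace (flag_rep n)"
  by (simp add: flag_rep_def)

lemma hecke_T_in_hecke_algebra: "w \<in> weyl_group n \<Longrightarrow> hecke_T n w \<in> hecke_algebra n"
  by (simp add: hecke_algebra_def cfun.span_base)

lemma flag_action_flag_rep:
  assumes "h \<in> hecke_algebra n"
  shows "flag_action n g h v \<in> flag_rep n"
  using hecke_algebra_invariant[OF assms]
  by (simp add: flag_rep_iff flag_action_def right_invariant_galg_mult group_algebra_def galg_mult_outside)

lemma flag_action_add: "flag_action n g h (u + v) = flag_action n g h u + flag_action n g h v"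
  by (simp add: flag_action_def galg_mult_add_left galg_mult_add_right)

lemma flag_action_cscale: "flag_action n g h (cscale c v) = cscale c (flag_action n g h v)"
  by (simp add: flag_action_def galg_mult_cscale_left galg_mult_cscale_right)

text \<open>
  In the frame \<open>v\<^sub>x\<close>, \<open>x \<in> G\<close>, with evaluation at \<open>x\<close> as coordinates, the diagonal coefficient at \<open>x\<close> is
  \<open>(g v\<^sub>x T\<^sub>w)(x)\<close>.  Since \<open>v\<^sub>x = x T\<^sub>1\<close> and \<open>T\<^sub>1 T\<^sub>w = T\<^sub>w\<close>, this is the value of \<open>T\<^sub>w\<close> at \<open>x\<^sup>-\<^sup>1 g\<^sup>-\<^sup>1 x\<close>.
\<close>

lemma flag_trace_eq_card:
  fixes g w :: "'a::{field,finite} mat"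
  assumes g: "g \<in> carrier (GL n)" and w: "w \<in> weyl_group n"
  shows "flag_trace n g (hecke_T n w) =
    of_nat (card {x \<in> carrier (GL n). inv\<^bsub>GL n\<^esub> x * inv\<^bsub>GL n\<^esub> g * x \<in> double_coset n w})
      / of_nat (card (borel_subgroup n :: 'a mat set))"
proof -
  let ?G = "carrier (GL n) :: 'a mat set" and ?T = "hecke_T n w"
  note T = hecke_T_in_hecke_algebra[OF w]
  have vec: "flag_vector n x \<in> flag_rep n" if "x \<in> ?G" for x
    unfolding flag_rep_def using that by (intro cfun.span_base imageI)
  have "flag_trace n g ?T = (\<Sum>x\<in>?G. flag_action n g ?T (flag_vector n x) x)"
    unfolding flag_trace_def
    by (rule trace_on_frame[where \<phi> = "\<lambda>x f. f x"])
      (simp_all add: subspace_flag_rep vec cscale_apply flag_action_flag_rep[OF T] flag_action_add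
        flag_action_cscale, simp add: flag_rep_iff right_invariant_expansion)
  also have "\<dots> = (\<Sum>x\<in>?G. ?T (inv\<^bsub>GL n\<^esub> x * inv\<^bsub>GL n\<^esub> g * x))"
  proof (intro sum.cong refl)
    fix x :: "'a mat" assume x: "x \<in> ?G"
    have "flag_action n g ?T (flag_vector n x) = galg_mult n (indicator {g}) (galg_mult n (indicator {x}) ?T)"
      using x left_invariant_fixed[of n ?T] hecke_algebra_invariant[OF T]
      by (simp add: flag_action_def flag_vector_eq galg_mult_assoc)
    then show "flag_action n g ?T (flag_vector n x) x = ?T (inv\<^bsub>GL n\<^esub> x * inv\<^bsub>GL n\<^esub> g * x)"
      using x g by (simp add: galg_mult_indicator GL.m_assoc[where n = n])
  qed
  also have "\<dots> = (\<Sum>x\<in>{x\<in>?G. inv\<^bsub>GL n\<^esub> x * inv\<^bsub>GL n\<^esub> g * x \<in> double_coset n w}.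
      1 / of_nat (card (borel_subgroup n :: 'a mat set)))"
    unfolding hecke_T_apply by (rule sum.inter_filter[symmetric]) simp
  finally show ?thesis by simp
qed

lemma card_lusztig_variety:
  fixes g w :: "'a::{field,finite} mat"
  assumes g: "g \<in> carrier (GL n)" and w: "w \<in> weyl_group n"
  shows "card (borel_subgroup n :: 'a mat set) * card (lusztig_variety n w g) =
    card {x \<in> carrier (GL n). inv\<^bsub>GL n\<^esub> x * g * x \<in> double_coset n w}"
proof -
  let ?G = "carrier (GL n) :: 'a mat set" and ?B = "borel_subgroup n :: 'a mat set"
  let ?Y = "lusztig_variety n w g"
  have Y: "?Y \<subseteq> lcosets\<^bsub>GL n\<^esub> ?B"
    by (auto simp: lusztig_variety_def LCOSETS_def)
  have "\<Union>?Y = {x \<in> ?G. inv\<^bsub>GL n\<^esub> x * g * x \<in> double_coset n w}"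
  proof (intro equalityI subsetI)
    fix x assume "x \<in> \<Union>?Y"
    then obtain y b where y: "y \<in> ?G" "inv\<^bsub>GL n\<^esub> y * g * y \<in> double_coset n w"
      and b: "b \<in> ?B" "x = y * b"
      by (auto simp: lusztig_variety_def l_coset_def mult_GL)
    have "inv\<^bsub>GL n\<^esub> x * g * x = inv\<^bsub>GL n\<^esub> b * (inv\<^bsub>GL n\<^esub> y * g * y) * b"
      using y b g by (simp add: GL.word_simps[where n = n] borel_subgroup_GL)
    then show "x \<in> {x \<in> ?G. inv\<^bsub>GL n\<^esub> x * g * x \<in> double_coset n w}"
      using y b g w by (simp add: mult_double_coset_iff weyl_group_GL borel_subgroup_GL)
  next
    fix x assume x: "x \<in> {x \<in> ?G. inv\<^bsub>GL n\<^esub> x * g * x \<in> double_coset n w}"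
    then have "x \<in> x <#\<^bsub>GL n\<^esub> ?B" using GL.lcos_self[OF _ subgroup_borel] by blast
    then show "x \<in> \<Union>?Y" using x by (auto simp: lusztig_variety_def)
  qed
  moreover have "card ?B * card ?Y = card (\<Union>?Y)"
  proof (rule card_partition)
    have "\<Union>?Y \<subseteq> ?G" by (simp add: calculation)
    then show "finite (\<Union>?Y)" by (rule finite_subset) simp
    then show "finite ?Y" by (rule finite_UnionD)
    show "card c = card ?B" if "c \<in> ?Y" for c
    proof -
      have "?B \<subseteq> ?G" using borel_subgroup_GL by blast
      then show ?thesis using GL.l_card_cosets_equal[OF _ _ finite_GL, of c n ?B] Y that by auto
    qed
    show "c1 \<inter> c2 = {}" if "c1 \<in> ?Y" "c2 \<in> ?Y" "c1 \<noteq> c2" for c1 c2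
      using GL.lcos_disjoint[OF subgroup_borel] Y that by blast
  qed
  ultimately show ?thesis by simp
qed

lemma card_flags:
  "card (flags n :: 'a::{field,finite} mat set set) * card (borel_subgroup n :: 'a mat set) =
    card (carrier (GL n) :: 'a mat set)"
  using GL.l_lagrange[OF finite_GL subgroup_borel] by (simp add: flags_def Coset.order_def)

lemma flag_trace_eq_lusztig:
  fixes g w :: "'a::{field,finite} mat"
  assumes g: "g \<in> carrier (GL n)" and w: "w \<in> weyl_group n"
  shows "flag_trace n g (hecke_T n w) = of_nat (card (lusztig_variety n w (inv\<^bsub>GL n\<^esub> g)))"
  using card_borel_pos[of n, where 'a = 'a]
  by (simp add: flag_trace_eq_card[OF assms] card_lusztig_variety[OF GL.inv_closed[OF g] w, symmetric])

lemma flag_trace_eq_class: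
  fixes g w :: "'a::{field,finite} mat"
  assumes g: "g \<in> carrier (GL n)" and w: "w \<in> weyl_group n"
  shows "flag_trace n g (hecke_T n w) =
    of_nat (card (flags n :: 'a mat set set)) / of_nat (card (GL_class n g))
      * of_nat (card (GL_class n g \<inter> double_coset n (inv\<^bsub>GL n\<^esub> w)))"
proof -
  let ?G = "carrier (GL n) :: 'a mat set" and ?S = "double_coset n (inv\<^bsub>GL n\<^esub> w)"
  let ?B = "borel_subgroup n :: 'a mat set"
  have "inv\<^bsub>GL n\<^esub> x * inv\<^bsub>GL n\<^esub> g * x \<in> double_coset n w \<longleftrightarrow> inv\<^bsub>GL n\<^esub> x * g * x \<in> ?S"
    if "x \<in> ?G" for x
  proof -
    have "inv\<^bsub>GL n\<^esub> (inv\<^bsub>GL n\<^esub> x * g * x) = inv\<^bsub>GL n\<^esub> x * inv\<^bsub>GL n\<^esub> g * x"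
      using g that by (simp add: GL.word_simps[where n = n])
    then show ?thesis
      using inv_double_coset_iff[OF weyl_group_GL[OF w], of "inv\<^bsub>GL n\<^esub> x * g * x"] g that by simp
  qed
  then have eq: "{x \<in> ?G. inv\<^bsub>GL n\<^esub> x * inv\<^bsub>GL n\<^esub> g * x \<in> double_coset n w} =
      {x \<in> ?G. inv\<^bsub>GL n\<^esub> x * g * x \<in> ?S}"
    by blast
  have "card {x \<in> ?G. inv\<^bsub>GL n\<^esub> x * g * x \<in> ?S} * card (GL_class n g) =
      card (flags n :: 'a mat set set) * card ?B * card (GL_class n g \<inter> ?S)"
    using GL.card_conjugation_preimage[OF finite_GL g, of ?S] by (simp add: conj_class_def card_flags)
  then have "of_nat (card {x \<in> ?G. inv\<^bsub>GL n\<^esub> x * g * x \<in> ?S}) * of_nat (card (GL_class n g)) =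
      (of_nat (card (flags n :: 'a mat set set)) * of_nat (card ?B) * of_nat (card (GL_class n g \<inter> ?S)) :: complex)"
    by (simp only: of_nat_mult[symmetric] of_nat_eq_iff)
  moreover have class_nonempty: "card (GL_class n g) \<noteq> 0"
  proof -
    have "g = 1\<^sub>m n * g * inv\<^bsub>GL n\<^esub> 1\<^sub>m n" using g by simp
    then have "g \<in> GL_class n g" unfolding conj_class_def using GL.one_closed by blast
    moreover have "GL_class n g \<subseteq> ?G" using g by (auto simp: conj_class_def)
    moreover from this have "finite (GL_class n g)" by (rule finite_subset) simp
    ultimately show ?thesis by (metis card_0_eq empty_iff)
  qed
  moreover have "N / b = F / C * I" if "N * C = F * b * I" "C \<noteq> 0" "b \<noteq> 0" for N C F b I :: complex
    using that by (simp add: field_simps)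
  moreover have "of_nat (card (GL_class n g)) \<noteq> (0::complex)" "of_nat (card ?B) \<noteq> (0::complex)"
    using class_nonempty card_borel_pos[of n, where 'a = 'a] by (simp_all only: of_nat_eq_0_iff not_False_eq_True neq0_conv)
  ultimately show ?thesis
    unfolding flag_trace_eq_card[OF assms] eq by blast
qed

lemma trace_sandwich_elementary:
  fixes A B :: "complex mat"
  assumes A: "A \<in> carrier_mat d d" and B: "B \<in> carrier_mat e e" and ij: "i < d" "j < e"
  shows "(A * mat d e (\<lambda>ab. if ab = (i, j) then 1 else 0) * B) $$ (i, j) = A $$ (i, i) * B $$ (j, j)"
proof -
  let ?E = "mat d e (\<lambda>ab. if ab = (i, j) then 1 else 0) :: complex mat"
  have E: "?E \<in> carrier_mat d e" by simp
  have AE: "(A * ?E) $$ (i, b) = (if b = j then A $$ (i, i) else 0)" if "b < e" for b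
  proof -
    have "(A * ?E) $$ (i, b) = (\<Sum>a<d. if a = i then if b = j then A $$ (i, i) else 0 else 0)"
      unfolding index_mult_mat_sum[OF A E ij(1) that] using that by (intro sum.cong) auto
    then show ?thesis using ij by simp
  qed
  have "(A * ?E * B) $$ (i, j) = (\<Sum>b<e. if b = j then A $$ (i, i) * B $$ (j, j) else 0)"
    unfolding index_mult_mat_sum[OF mult_carrier_mat[OF A E] B ij] using AE by (intro sum.cong) auto
  then show ?thesis using ij by simp
qed

text \<open>
  The bimodule isomorphism turns the action into \<open>X \<mapsto> \<rho>\<^sub>G(g) X \<rho>\<^sub>H(h)\<close> on each block of matrices.
  The preimages of the elementary matrices form a basis of the flag representation, in which
  the trace of every block is a product of two traces.
\<close>

lemma flag_trace_eq_characters: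
  fixes g :: "'a::{field,finite} mat" and dG dH :: "'l \<Rightarrow> nat"
  assumes g: "g \<in> carrier (GL n)" and h: "h \<in> hecke_algebra n" and fin: "finite \<Lambda>"
    and dec: "flag_bimodule_decomposition n \<Lambda> dG \<rho>G dH \<rho>H"
    and \<rho>H: "\<And>l. l \<in> \<Lambda> \<Longrightarrow> \<rho>H l h \<in> carrier_mat (dH l) (dH l)"
  shows "flag_trace n g h = (\<Sum>l\<in>\<Lambda>. mat_trace (\<rho>G l g) * mat_trace (\<rho>H l h))"
proof -
  let ?V = "flag_rep n :: ('a mat \<Rightarrow> complex) set"
  let ?P = "\<Pi>\<^sub>E l\<in>\<Lambda>. carrier_mat (dG l) (dH l) :: complex mat set"
  obtain \<Phi> where bij: "bij_betw \<Phi> ?V ?P"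
    and add: "\<And>u v l. u \<in> ?V \<Longrightarrow> v \<in> ?V \<Longrightarrow> l \<in> \<Lambda> \<Longrightarrow> \<Phi> (u + v) l = \<Phi> u l + \<Phi> v l"
    and scale: "\<And>c v l. v \<in> ?V \<Longrightarrow> l \<in> \<Lambda> \<Longrightarrow> \<Phi> (cscale c v) l = c \<cdot>\<^sub>m \<Phi> v l"
    and act: "\<And>v l. v \<in> ?V \<Longrightarrow> l \<in> \<Lambda> \<Longrightarrow> \<Phi> (flag_action n g h v) l = \<rho>G l g * \<Phi> v l * \<rho>H l h"
  proof -
    from dec obtain \<Phi> where "bij_betw \<Phi> ?V ?P"
      and "\<forall>v\<in>?V. \<forall>u\<in>?V. \<forall>l\<in>\<Lambda>. \<Phi> (v + u) l = \<Phi> v l + \<Phi> u l"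
      and "\<forall>c. \<forall>v\<in>?V. \<forall>l\<in>\<Lambda>. \<Phi> (cscale c v) l = c \<cdot>\<^sub>m \<Phi> v l"
      and "\<forall>g\<in>carrier (GL n). \<forall>h\<in>hecke_algebra n. \<forall>v\<in>?V. \<forall>l\<in>\<Lambda>.
        \<Phi> (flag_action n g h v) l = \<rho>G l g * \<Phi> v l * \<rho>H l h"
      unfolding flag_bimodule_decomposition_def by (elim conjE exE) (rule that)
    then show thesis using g h by (intro that[of \<Phi>]) simp_all
  qed
  have \<rho>G: "\<rho>G l g \<in> carrier_mat (dG l) (dG l)" if "l \<in> \<Lambda>" for l
  proof -
    have "\<rho>G l \<in> hom (GL n) (GL (dG l))"
      using dec that by (simp add: flag_bimodule_decomposition_def irreducible_G_module_def)
    then show ?thesis using g by (intro GL_carrier_mat) (auto simp: hom_def)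
  qed
  have \<Phi>M: "\<Phi> v l \<in> carrier_mat (dG l) (dH l)" if "v \<in> ?V" "l \<in> \<Lambda>" for v l
    using bij_betwE[OF bij] that by (auto simp: PiE_iff)
  let ?I = "SIGMA l:\<Lambda>. {..<dG l} \<times> {..<dH l}"
  define \<phi> where "\<phi> = (\<lambda>(l, ij) v. \<Phi> v l $$ ij)"
  \<comment> \<open>the elementary matrix \<open>ij\<close> in block \<open>l\<close>, as an extensional function on \<open>\<Lambda>\<close>\<close>
  define E where "E = (\<lambda>(l, ij) m. if m \<in> \<Lambda> then
      mat (dG m) (dH m) (\<lambda>ab. if m = l \<and> ab = ij then 1 else 0 :: complex) else undefined)"
  define e where "e i = inv_into ?V \<Phi> (E i)" for i
  have E: "E i \<in> ?P" for i by (auto simp: E_def PiE_iff extensional_def split: prod.splits)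
  have e: "e i \<in> ?V" "\<Phi> (e i) = E i" for i
  proof -
    have "E i \<in> \<Phi> ` ?V" using E[of i] bij unfolding bij_betw_def by metis
    then show "e i \<in> ?V" "\<Phi> (e i) = E i" unfolding e_def by (rule inv_into_into, rule f_inv_into_f)
  qed
  have \<phi>_add: "\<phi> i (x + y) = \<phi> i x + \<phi> i y" if "i \<in> ?I" "x \<in> ?V" "y \<in> ?V" for i x y
  proof -
    obtain l a b where i: "i = (l, a, b)" "l \<in> \<Lambda>" "a < dG l" "b < dH l" using \<open>i \<in> ?I\<close> by auto
    then show ?thesis
      using \<Phi>M[OF that(2) i(2)] \<Phi>M[OF that(3) i(2)] that by (simp add: \<phi>_def add)
  qed
  have \<phi>_scale: "\<phi> i (cscale c x) = c * \<phi> i x" if "i \<in> ?I" "x \<in> ?V" for i c x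
  proof -
    obtain l a b where i: "i = (l, a, b)" "l \<in> \<Lambda>" "a < dG l" "b < dH l" using \<open>i \<in> ?I\<close> by auto
    then show ?thesis
      using \<Phi>M[OF that(2) i(2)] that by (simp add: \<phi>_def scale)
  qed
  have \<phi>_e: "\<phi> i (e j) = (if i = j then 1 else 0)" if "i \<in> ?I" for i j
    using that by (cases j) (auto simp: \<phi>_def e E_def split: if_splits)
  have determined: "x = y" if xy: "x \<in> ?V" "y \<in> ?V" and eq: "\<And>i. i \<in> ?I \<Longrightarrow> \<phi> i x = \<phi> i y" for x y
  proof -
    have "\<Phi> x = \<Phi> y"
    proof (rule PiE_ext)
      show "\<Phi> x \<in> ?P" "\<Phi> y \<in> ?P" using xy bij_betwE[OF bij] by auto
      fix l assume l: "l \<in> \<Lambda>"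
      show "\<Phi> x l = \<Phi> y l"
        using \<Phi>M[OF xy(1) l] \<Phi>M[OF xy(2) l] eq[of "(l, _, _)"] l by (intro eq_matI) (auto simp: \<phi>_def)
    qed
    then show ?thesis using bij xy by (auto simp: bij_betw_def dest: inj_onD)
  qed
  have finI: "finite ?I" using fin by simp
  have zero: "\<phi> i 0 = 0" if "i \<in> ?I" for i
    using \<phi>_add[OF that cfun.subspace_0 cfun.subspace_0, OF subspace_flag_rep subspace_flag_rep] by simp
  have comb: "(\<Sum>j\<in>J. cscale (c j) (e j)) \<in> ?V" for J c
    using subspace_flag_rep e(1) by (intro cfun.subspace_sum cfun.subspace_scale)
  have \<phi>_sum: "\<phi> i (\<Sum>j\<in>J. cscale (c j) (e j)) = (\<Sum>j\<in>J. c j * \<phi> i (e j))" if "finite J" "i \<in> ?I" for i J c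
    using that
    by (induction J) (simp_all add: zero \<phi>_add \<phi>_scale comb e cfun.subspace_scale[OF subspace_flag_rep])
  have "flag_trace n g h = (\<Sum>i\<in>?I. \<phi> i (flag_action n g h (e i)))"
    unfolding flag_trace_def
  proof (rule trace_on_frame[OF subspace_flag_rep finI])
    fix x assume x: "x \<in> ?V"
    show "x = (\<Sum>i\<in>?I. cscale (\<phi> i x) (e i))"
    proof (rule determined[OF x comb])
      fix i assume i: "i \<in> ?I"
      have "(\<Sum>j\<in>?I. \<phi> j x * \<phi> i (e j)) = (\<Sum>j\<in>?I. if i = j then \<phi> j x else 0)"
        using i by (intro sum.cong) (auto simp: \<phi>_e)
      also have "\<dots> = \<phi> i x" using i finI by simp
      finally show "\<phi> i x = \<phi> i (\<Sum>i\<in>?I. cscale (\<phi> i x) (e i))"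
        using \<phi>_sum[OF finI i, of "\<lambda>j. \<phi> j x"] by simp
    qed
  qed (rule e(1) flag_action_flag_rep[OF h] flag_action_add flag_action_cscale
      | (rule \<phi>_add \<phi>_scale; assumption))+
  also have "\<dots> = (\<Sum>(l, i, j)\<in>?I. \<rho>G l g $$ (i, i) * \<rho>H l h $$ (j, j))"
  proof (intro sum.cong refl)
    fix k assume "k \<in> ?I"
    then obtain l i j where k: "k = (l, i, j)" and l: "l \<in> \<Lambda>" and ij: "i < dG l" "j < dH l" by auto
    have "E k l = mat (dG l) (dH l) (\<lambda>ab. if ab = (i, j) then 1 else 0)"
      using l by (simp add: E_def k)
    then show "\<phi> k (flag_action n g h (e k)) = (case k of (l, i, j) \<Rightarrow> \<rho>G l g $$ (i, i) * \<rho>H l h $$ (j, j))"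
      using trace_sandwich_elementary[OF \<rho>G[OF l] \<rho>H[OF l] ij]
      by (simp add: k \<phi>_def act[OF e(1) l] e(2))
  qed
  also have "\<dots> = (\<Sum>l\<in>\<Lambda>. \<Sum>(i, j)\<in>{..<dG l} \<times> {..<dH l}. \<rho>G l g $$ (i, i) * \<rho>H l h $$ (j, j))"
    using fin by (subst sum.Sigma) (auto simp: case_prod_unfold)
  also have "\<dots> = (\<Sum>l\<in>\<Lambda>. mat_trace (\<rho>G l g) * mat_trace (\<rho>H l h))"
    by (intro sum.cong)
      (auto simp: mat_trace_def sum_product sum.cartesian_product carrier_matD(1)[OF \<rho>G] carrier_matD(1)[OF \<rho>H])
  finally show ?thesis .
qed


section \<open>The central element\<close>

lemma double_coset_eq:
  fixes v x :: "'a::{field,finite} mat"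
  assumes v: "v \<in> carrier (GL n)" and x: "x \<in> double_coset n v"
  shows "double_coset n x = double_coset n v"
proof -
  have xG: "x \<in> carrier (GL n)" using double_coset_subset_GL[OF v] x by blast
  obtain c c' where c: "c \<in> borel_subgroup n" "c' \<in> borel_subgroup n" "x = c * v * c'"
    using x by (auto simp: double_coset_def)
  then have "v \<in> double_coset n x"
    using self_in_double_coset[OF xG] v mult_double_coset_iff[OF xG]
    by (simp add: borel_subgroup_GL)
  have "double_coset n y \<subseteq> double_coset n z"
    if "z \<in> carrier (GL n)" "y \<in> carrier (GL n)" "y \<in> double_coset n z" for y z :: "'a mat"
    using that mult_double_coset_iff[OF that(1)]
    by (auto simp: double_coset_def[of n y] borel_subgroup_GL)
  then show ?thesis using v xG x \<open>v \<in> double_coset n x\<close> by blast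
qed

lemma qlen_card_double_coset:
  fixes w :: "'a::{field,finite} mat"
  assumes "w \<in> weyl_group n"
  shows "qlen n w * of_nat (card (double_coset n w)) = of_nat (card (borel_subgroup n :: 'a mat set))"
  using card_field_ge_2[where 'a = 'a]
  by (simp add: qlen_def card_double_coset[OF assms] power_int_minus field_simps)

lemma qlen_nonzero: "qlen n (w :: 'a::{field,finite} mat) \<noteq> 0"
  using card_field_ge_2[where 'a = 'a] by (simp add: qlen_def power_int_minus)

lemma qlen_inv: "w \<in> weyl_group n \<Longrightarrow> qlen n (inv\<^bsub>GL n\<^esub> w) = qlen n w"
  by (simp add: qlen_def weyl_length_inv)

text \<open>
  Written in terms of \<open>T\<^sub>w\<close> instead of \<open>T\<close> at \<open>w\<^sup>-\<^sup>1\<close>, so that coefficients can be read off at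
  the points of \<open>B w B\<close>.
\<close>

lemma A_elem_alt:
  fixes g :: "'a::{field,finite} mat"
  shows "A_elem n g =
    (\<Sum>w\<in>weyl_group n. cscale (flag_trace n g (hecke_T n (inv\<^bsub>GL n\<^esub> w)) * qlen n w) (hecke_T n w))"
  unfolding A_elem_def
  by (rule sum.reindex_bij_witness[of _ "m_inv (GL n)" "m_inv (GL n)"])
     (auto simp: weyl_group_inv weyl_group_GL qlen_inv)

lemma scaled_class_sum_conj:
  fixes g x y :: "'a::{field,finite} mat"
  assumes g: "g \<in> carrier (GL n)" and "x \<in> carrier (GL n)" "y \<in> carrier (GL n)"
  shows "scaled_class_sum n g (x * y) = scaled_class_sum n g (y * x)"
proof -
  have "y * x \<in> GL_class n g" if xy: "x \<in> carrier (GL n)" "y \<in> carrier (GL n)" "x * y \<in> GL_class n g"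
    for x y
  proof -
    obtain u where u: "u \<in> carrier (GL n)" "x * y = u * g * inv\<^bsub>GL n\<^esub> u"
      using xy(3) by (auto simp: conj_class_def)
    have "y * x = y * (x * y) * inv\<^bsub>GL n\<^esub> y"
      using xy by (simp add: GL.m_assoc[where n = n])
    also have "\<dots> = (y * u) * g * inv\<^bsub>GL n\<^esub> (y * u)"
      unfolding u(2) using xy u(1) g by (simp add: GL.word_simps[where n = n])
    finally show ?thesis
      unfolding conj_class_def using xy u by blast
  qed
  from this[of x y] this[of y x] show ?thesis
    using assms by (auto simp: scaled_class_sum_def cscale_def indicator_def)
qed

lemma scaled_class_sum_group_algebra:
  fixes g :: "'a::{field,finite} mat"
  assumes "g \<in> carrier (GL n)"
  shows "scaled_class_sum n g \<in> group_algebra n"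
  using assms by (auto simp: group_algebra_def scaled_class_sum_def cscale_def indicator_def conj_class_def)

text \<open>
  Let \<open>S = |G/B| / |\<C>\<^sub>g| \<cdot> C\<^sub>g\<close>.  At \<open>x \<in> B v B\<close> the function \<open>T\<^sub>1 S T\<^sub>1\<close> is the average of \<open>S (b x b')\<close> over
  \<open>b, b' \<in> B\<close>, and as \<open>(b, b') \<mapsto> b x b'\<close> covers \<open>B v B\<close> uniformly, this is
  \<open>|G/B| / |\<C>\<^sub>g| \<cdot> |\<C>\<^sub>g \<inter> B v B| / |B v B|\<close>.  The value of \<open>A\<^sub>g\<close> at \<open>x\<close> is the trace of \<open>g\<close> and \<open>T\<close> at \<open>v\<^sup>-\<^sup>1\<close>, given by
  the class formula, multiplied by \<open>q\<^bsup>-l(v)\<^esup> / |B| = 1 / |B v B|\<close>.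
\<close>

lemma A_elem_eq_sandwich:
  fixes g :: "'a::{field,finite} mat"
  assumes g: "g \<in> carrier (GL n)"
  shows "A_elem n g =
    galg_mult n (hecke_T n (1\<^sub>m n)) (galg_mult n (scaled_class_sum n g) (hecke_T n (1\<^sub>m n)))"
    (is "_ = ?R")
proof
  fix x :: "'a mat"
  let ?B = "borel_subgroup n :: 'a mat set" and ?C = "GL_class n g"
  let ?s = "of_nat (card (flags n :: 'a mat set set)) / of_nat (card ?C) :: complex"
  show "A_elem n g x = ?R x"
  proof (cases "x \<in> carrier (GL n)")
    case True
    then obtain v where v: "v \<in> weyl_group n" "x \<in> double_coset n v" by (rule GL_in_double_coset)
    have vx: "double_coset n x = double_coset n v"
      using v by (intro double_coset_eq weyl_group_GL)
    let ?I = "of_nat (card (?C \<inter> double_coset n v)) :: complex"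
    let ?N = "of_nat (card (double_coset n v)) :: complex"
    let ?b = "of_nat (card ?B) :: complex"
    let ?D = "of_nat (card (borel_stabilizer n x)) :: complex"
    have L: "A_elem n g x = ?s * ?I * qlen n v / ?b"
      using v g by (simp add: A_elem_alt hecke_sum_apply flag_trace_eq_class weyl_group_inv weyl_group_GL)
    have R: "?R x = ?s * (?D * ?I) / ?b / ?b"
    proof -
      have "?R x = (\<Sum>b\<in>?B. (\<Sum>b'\<in>?B. scaled_class_sum n g (b * x * b')) / ?b) / ?b"
        using True by (simp add: galg_mult_borel_left galg_mult_borel_right borel_subgroup_GL)
      also have "\<dots> = (\<Sum>b\<in>?B. \<Sum>b'\<in>?B. scaled_class_sum n g (b * x * b')) / ?b / ?b"
        by (simp add: sum_divide_distrib)
      also have "(\<Sum>b\<in>?B. \<Sum>b'\<in>?B. scaled_class_sum n g (b * x * b')) =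
          (\<Sum>p\<in>?B \<times> ?B. if (case p of (b, b') \<Rightarrow> b * x * b' \<in> ?C) then ?s else 0)"
        unfolding sum.cartesian_product
        by (intro sum.cong) (auto simp: scaled_class_sum_def cscale_def)
      also have "\<dots> = (\<Sum>p\<in>{p \<in> ?B \<times> ?B. case p of (b, b') \<Rightarrow> b * x * b' \<in> ?C}. ?s)"
        by (rule sum.inter_filter[symmetric]) simp
      also have "\<dots> = of_nat (card {p \<in> ?B \<times> ?B. case p of (b, b') \<Rightarrow> b * x * b' \<in> ?C}) * ?s"
        by simp
      also have "{p \<in> ?B \<times> ?B. case p of (b, b') \<Rightarrow> b * x * b' \<in> ?C} =
          {(b, b') \<in> ?B \<times> ?B. b * x * b' \<in> ?C}"
        by auto
      also have "of_nat (card {(b, b') \<in> ?B \<times> ?B. b * x * b' \<in> ?C}) = ?D * ?I"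
        using card_double_coset_Int[OF True, of ?C] vx by simp
      finally show ?thesis by (simp add: mult.commute)
    qed
    have D: "?D * ?N = ?b * ?b"
      using card_double_coset_mult[OF True] unfolding vx power2_eq_square
      by (simp only: of_nat_mult[symmetric] of_nat_eq_iff)
    have Q: "qlen n v * ?N = ?b" by (rule qlen_card_double_coset[OF v(1)])
    have b: "?b \<noteq> 0" by simp
    have "?N \<noteq> 0" using Q b by (metis mult_zero_right)
    moreover have "?D * ?N = qlen n v * ?b * ?N" using D Q by (metis mult.assoc mult.commute)
    ultimately have "?D = qlen n v * ?b" by (metis mult_right_cancel)
    moreover have "s * (q * b * I) / b / b = s * I * q / b" if "b \<noteq> 0" for s q b I :: complex
      using that by (simp add: field_simps)
    ultimately show ?thesis unfolding L R using b by metis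
  next
    case False
    then have "x \<notin> double_coset n w" if "w \<in> weyl_group n" for w
      using double_coset_subset_GL[OF weyl_group_GL[OF that]] by blast
    then show ?thesis
      using False by (simp add: A_elem_alt sum_fun_apply cscale_apply hecke_T_apply galg_mult_outside)
  qed
qed

lemma A_elem_hecke_algebra: "A_elem n g \<in> hecke_algebra n"
  unfolding A_elem_alt hecke_algebra_def
  by (intro cfun.span_sum cfun.span_scale cfun.span_base imageI)

text \<open>
  As \<open>S\<close> is central, \<open>v T\<^sub>1 S T\<^sub>1 = S v T\<^sub>1 T\<^sub>1\<close>, and \<open>T\<^sub>1\<close> fixes \<open>v\<close>.
\<close>

lemma galg_mult_A_elem_right:
  fixes v :: "'a::{field,finite} mat \<Rightarrow> complex"
  assumes g: "g \<in> carrier (GL n)" and v: "v \<in> group_algebra n" "right_invariant n v"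
  shows "galg_mult n v (A_elem n g) = galg_mult n (scaled_class_sum n g) v"
proof -
  let ?E = "hecke_T n (1\<^sub>m n)" and ?S = "scaled_class_sum n g"
  note S = class_function_central[of n ?S, OF scaled_class_sum_conj[OF g]]
  have "galg_mult n v (A_elem n g) = galg_mult n (galg_mult n v ?E) (galg_mult n ?S ?E)"
    by (simp add: A_elem_eq_sandwich[OF g] galg_mult_assoc)
  also have "\<dots> = galg_mult n v (galg_mult n ?E ?S)"
    using v by (simp add: right_invariant_fixed S)
  also have "\<dots> = galg_mult n (galg_mult n v ?E) ?S"
    by (simp add: galg_mult_assoc)
  finally show ?thesis using v by (simp add: right_invariant_fixed S)
qed

lemma galg_mult_A_elem_left:
  fixes v :: "'a::{field,finite} mat \<Rightarrow> complex"
  assumes g: "g \<in> carrier (GL n)" and v: "v \<in> group_algebra n" "left_invariant n v"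
  shows "galg_mult n (A_elem n g) v = galg_mult n (scaled_class_sum n g) v"
proof -
  let ?E = "hecke_T n (1\<^sub>m n)" and ?S = "scaled_class_sum n g"
  note S = class_function_central[of n ?S, OF scaled_class_sum_conj[OF g]]
  have "galg_mult n (A_elem n g) v = galg_mult n (galg_mult n ?E ?S) v"
    using v by (simp add: A_elem_eq_sandwich[OF g] galg_mult_assoc left_invariant_fixed)
  also have "\<dots> = galg_mult n ?S v"
    using v by (simp add: S[symmetric] galg_mult_assoc left_invariant_fixed)
  finally show ?thesis .
qed

lemma A_elem_central:
  fixes g :: "'a::{field,finite} mat"
  assumes g: "g \<in> carrier (GL n)"
  shows "A_elem n g \<in> center_of n (hecke_algebra n)"
  unfolding center_of_def
proof (intro CollectI conjI ballI A_elem_hecke_algebra)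
  fix h :: "'a mat \<Rightarrow> complex" assume "h \<in> hecke_algebra n"
  note h = hecke_algebra_invariant[OF this]
  show "galg_mult n (A_elem n g) h = galg_mult n h (A_elem n g)"
    using galg_mult_A_elem_left[OF g h(1,3)] galg_mult_A_elem_right[OF g h(1,2)] by simp
qed

lemma scaled_class_sum_central:
  assumes "g \<in> carrier (GL n)"
  shows "scaled_class_sum n g \<in> center_of n (group_algebra n)"
  unfolding center_of_def
  using scaled_class_sum_group_algebra[OF assms] class_function_central[of n "scaled_class_sum n g", OF scaled_class_sum_conj[OF assms]]
  by blast


section \<open>The Geck--Rouquier expansion\<close>

lemma weyl_group_conj_inverse:
  fixes w :: "'a::field mat"
  assumes "w \<in> weyl_group n"
  shows "\<exists>s\<in>weyl_group n. s * w * inv\<^bsub>GL n\<^esub> s = inv\<^bsub>GL n\<^esub> w"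
proof -
  obtain p where p: "p permutes {..<n}" "w = perm_mat n p" using assms by (auto simp: weyl_group_def)
  obtain s where s: "s permutes {..<n}" "s \<circ> p \<circ> Hilbert_Choice.inv s = Hilbert_Choice.inv p"
    using permutation_conj_inverse[OF p(1)] by auto
  have "(perm_mat n s :: 'a mat) * w * inv\<^bsub>GL n\<^esub> (perm_mat n s) = inv\<^bsub>GL n\<^esub> w"
    using p s by (simp add: inv_perm_mat perm_mat_mult permutes_compose permutes_inv)
  then show ?thesis using s(1) unfolding weyl_group_def by blast
qed

lemma weyl_group_mult: "u \<in> weyl_group n \<Longrightarrow> w \<in> weyl_group n \<Longrightarrow> u * w \<in> weyl_group n"
  unfolding weyl_group_def by (auto simp: perm_mat_mult permutes_compose intro!: imageI)

lemma weyl_class_subset: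
  assumes "\<nu> \<in> weyl_classes n"
  shows "\<nu> \<subseteq> weyl_group n"
  using assms by (auto simp: weyl_classes_def conj_class_def weyl_group_mult weyl_group_inv)

text \<open>
  Every permutation is conjugate to its inverse, and inversion preserves lengths.
\<close>

lemma min_length_elements_inv:
  fixes w :: "'a::{field,finite} mat"
  assumes \<nu>: "\<nu> \<in> weyl_classes n" and w: "w \<in> min_length_elements n \<nu>"
  shows "inv\<^bsub>GL n\<^esub> w \<in> min_length_elements n \<nu>"
proof -
  have wW: "w \<in> weyl_group n" "w \<in> \<nu>"
    using weyl_class_subset[OF \<nu>] w by (auto simp: min_length_elements_def)
  obtain u where u: "u \<in> weyl_group n" "\<nu> = conj_class n (weyl_group n) u"
    using \<nu> by (auto simp: weyl_classes_def)
  obtain x where x: "x \<in> weyl_group n" "w = x * u * inv\<^bsub>GL n\<^esub> x"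
    using wW u by (auto simp: conj_class_def)
  obtain s where s: "s \<in> weyl_group n" "s * w * inv\<^bsub>GL n\<^esub> s = inv\<^bsub>GL n\<^esub> w"
    using weyl_group_conj_inverse[OF wW(1)] by auto
  have "inv\<^bsub>GL n\<^esub> w = (s * x) * u * inv\<^bsub>GL n\<^esub> (s * x)"
  proof -
    have "inv\<^bsub>GL n\<^esub> w = s * (x * u * inv\<^bsub>GL n\<^esub> x) * inv\<^bsub>GL n\<^esub> s"
      using s(2) x(2) by simp
    then show ?thesis
      using s(1) x(1) u(1) by (simp add: GL.word_simps[where n = n] weyl_group_GL)
  qed
  then have "inv\<^bsub>GL n\<^esub> w \<in> \<nu>"
    unfolding u(2) conj_class_def using weyl_group_mult[OF s(1) x(1)] by blast
  then show ?thesis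
    using w wW weyl_length_inv[OF wW(1)] by (simp add: min_length_elements_def)
qed

text \<open>
  The coefficient of \<open>\<kappa>\<^sub>\<mu>\<close> is read off at a minimal length element of the class \<open>\<mu>\<close>.  The coefficient of
  \<open>T\<^sub>u\<close> in \<open>A\<^sub>g\<close> is the trace at \<open>u\<^sup>-\<^sup>1\<close> times \<open>q\<^bsup>-l(u)\<^esup>\<close>; taking \<open>u = \<gamma>\<^sub>\<mu>\<^sup>-\<^sup>1\<close>, again of minimal
  length in \<open>\<mu>\<close>, gives the trace at \<open>\<gamma>\<^sub>\<mu>\<close> itself.
\<close>

lemma A_elem_geck_rouquier:
  fixes g :: "'a::{field,finite} mat"
  assumes g: "g \<in> carrier (GL n)" and \<kappa>: "geck_rouquier_basis n \<kappa>"
    and \<gamma>: "\<And>\<nu>. \<nu> \<in> weyl_classes n \<Longrightarrow> \<gamma> \<nu> \<in> min_length_elements n \<nu>"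
  shows "A_elem n g = (\<Sum>\<nu>\<in>weyl_classes n. cscale (flag_trace n g (hecke_T n (\<gamma> \<nu>))) (\<kappa> \<nu>))"
proof -
  let ?W = "weyl_classes n :: 'a mat set set" and ?b = "of_nat (card (borel_subgroup n :: 'a mat set)) :: complex"
  have inj: "inj_on \<kappa> ?W" and span: "cfun.span (\<kappa> ` ?W) = center_of n (hecke_algebra n)"
    using \<kappa> by (simp_all add: geck_rouquier_basis_def)
  obtain k where k: "\<And>\<nu>. \<nu> \<in> ?W \<Longrightarrow> \<kappa> \<nu> = (\<Sum>w\<in>weyl_group n. cscale (k \<nu> w * qlen n w) (hecke_T n w))"
    and dual: "\<And>\<nu> \<mu> w. \<nu> \<in> ?W \<Longrightarrow> \<mu> \<in> ?W \<Longrightarrow> w \<in> min_length_elements n \<mu> \<Longrightarrow> k \<nu> w = (if \<nu> = \<mu> then 1 else 0)"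
    using \<kappa> unfolding geck_rouquier_basis_def by blast
  have finW: "finite ?W" by (simp add: weyl_classes_def)
  have "A_elem n g \<in> cfun.span (\<kappa> ` ?W)"
    unfolding span by (rule A_elem_central[OF g])
  then obtain u where "A_elem n g = (\<Sum>z\<in>\<kappa> ` ?W. cscale (u z) z)"
    using cfun.span_finite[of "\<kappa> ` ?W"] finW by auto
  then have A: "A_elem n g = (\<Sum>\<nu>\<in>?W. cscale (u (\<kappa> \<nu>)) (\<kappa> \<nu>))"
    by (simp add: sum.reindex[OF inj])
  have "u (\<kappa> \<mu>) = flag_trace n g (hecke_T n (\<gamma> \<mu>))" if \<mu>: "\<mu> \<in> ?W" for \<mu>
  proof -
    let ?m = "inv\<^bsub>GL n\<^esub> (\<gamma> \<mu>)"
    have m: "?m \<in> min_length_elements n \<mu>"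
      by (rule min_length_elements_inv[OF \<mu> \<gamma>[OF \<mu>]])
    have W: "\<gamma> \<mu> \<in> weyl_group n" "?m \<in> weyl_group n"
      using weyl_class_subset[OF \<mu>] m \<gamma>[OF \<mu>] by (auto simp: min_length_elements_def)
    note self = self_in_double_coset[OF weyl_group_GL[OF W(2)]]
    have "A_elem n g ?m = flag_trace n g (hecke_T n (\<gamma> \<mu>)) * qlen n ?m / ?b"
      using W by (simp add: A_elem_alt hecke_sum_apply[OF W(2) self] weyl_group_GL)
    moreover have "A_elem n g ?m = u (\<kappa> \<mu>) * qlen n ?m / ?b"
    proof -
      have "A_elem n g ?m = (\<Sum>\<nu>\<in>?W. if \<nu> = \<mu> then u (\<kappa> \<nu>) * qlen n ?m / ?b else 0)"
        unfolding A sum_fun_apply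
      proof (intro sum.cong refl)
        fix \<nu> assume \<nu>: "\<nu> \<in> ?W"
        have "\<kappa> \<nu> ?m = k \<nu> ?m * qlen n ?m / ?b"
          unfolding k[OF \<nu>] by (rule hecke_sum_apply[OF W(2) self])
        then show "cscale (u (\<kappa> \<nu>)) (\<kappa> \<nu>) ?m = (if \<nu> = \<mu> then u (\<kappa> \<nu>) * qlen n ?m / ?b else 0)"
          using dual[OF \<nu> \<mu> m] by (simp add: cscale_apply)
      qed
      then show ?thesis using finW \<mu> by simp
    qed
    ultimately show ?thesis
      using qlen_nonzero[of n ?m] card_borel_pos[of n, where 'a = 'a] by simp
  qed
  then show ?thesis unfolding A by (intro sum.cong) simp_all
qed


section \<open>The expansion in central idempotents\<close>

lemma mat_trace_one_irreducible_G_module: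
  assumes "irreducible_G_module n d \<rho>"
  shows "mat_trace (\<rho> (1\<^sub>m n)) \<noteq> 0"
proof -
  have "\<rho> (1\<^sub>m n) = 1\<^sub>m d"
    using hom_one[of \<rho> "GL n" "GL d"] assms by (simp add: irreducible_G_module_def group_GL one_GL)
  then show ?thesis
    using assms by (simp add: irreducible_G_module_def acts_irreducibly_def mat_trace_def)
qed

text \<open>
  The factor \<open>\<chi>\<^sub>G(1) / |G/B|\<close> in front of each idempotent cancels, which leaves the definition of \<open>A\<^sub>g\<close>
  with the traces replaced by their character expansions.
\<close>

lemma A_elem_central_idempotents:
  fixes g :: "'a::{field,finite} mat"
  assumes fin: "finite \<Lambda>" and \<rho>G: "\<And>l. l \<in> \<Lambda> \<Longrightarrow> mat_trace (\<rho>G l (1\<^sub>m n)) \<noteq> 0"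
    and trace: "\<And>w. w \<in> weyl_group n \<Longrightarrow>
      flag_trace n g (hecke_T n w) = (\<Sum>l\<in>\<Lambda>. mat_trace (\<rho>G l g) * mat_trace (\<rho>H l (hecke_T n w)))"
  shows "A_elem n g = cscale (of_nat (card (flags n :: 'a mat set set)))
    (\<Sum>l\<in>\<Lambda>. cscale (mat_trace (\<rho>G l g) / mat_trace (\<rho>G l (1\<^sub>m n))) (central_idempotent n (\<rho>G l) (\<rho>H l)))"
proof
  fix x :: "'a mat"
  let ?F = "of_nat (card (flags n :: 'a mat set set)) :: complex"
  let ?T = "\<lambda>w. hecke_T n (inv\<^bsub>GL n\<^esub> w) x"
  have F: "?F \<noteq> 0"
  proof -
    have "card (carrier (GL n) :: 'a mat set) \<noteq> 0" using GL.one_closed[of n, where 'a = 'a] finite_GL by (metis card_0_eq empty_iff)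
    then show ?thesis using card_flags[of n, where 'a = 'a] by (metis mult_0 of_nat_eq_0_iff)
  qed
  have "A_elem n g x = (\<Sum>w\<in>weyl_group n. \<Sum>l\<in>\<Lambda>.
      mat_trace (\<rho>G l g) * (mat_trace (\<rho>H l (hecke_T n w)) * qlen n w * ?T w))"
    unfolding A_elem_def sum_fun_apply cscale_apply
    by (intro sum.cong) (simp_all add: trace sum_distrib_right mult.assoc)
  also have "\<dots> = (\<Sum>l\<in>\<Lambda>. mat_trace (\<rho>G l g) *
      (\<Sum>w\<in>weyl_group n. mat_trace (\<rho>H l (hecke_T n w)) * qlen n w * ?T w))"
    by (subst sum.swap) (simp add: sum_distrib_left)
  also have "\<dots> = (\<Sum>l\<in>\<Lambda>. ?F * (mat_trace (\<rho>G l g) / mat_trace (\<rho>G l (1\<^sub>m n)) *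
      central_idempotent n (\<rho>G l) (\<rho>H l) x))"
    using F \<rho>G by (intro sum.cong) (simp_all add: central_idempotent_def cscale_apply sum_fun_apply)
  finally show "A_elem n g x = cscale ?F
    (\<Sum>l\<in>\<Lambda>. cscale (mat_trace (\<rho>G l g) / mat_trace (\<rho>G l (1\<^sub>m n))) (central_idempotent n (\<rho>G l) (\<rho>H l))) x"
    by (simp add: cscale_apply sum_fun_apply sum_distrib_left)
qed

theorem proposition2p1:
  fixes n :: nat
    and g :: "'a::{field,finite} mat"
    and \<Lambda> :: "'l set"
    and dG dH :: "'l \<Rightarrow> nat"
    and \<rho>G :: "'l \<Rightarrow> 'a mat \<Rightarrow> complex mat"
    and \<rho>H :: "'l \<Rightarrow> ('a mat \<Rightarrow> complex) \<Rightarrow> complex mat"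
    and \<kappa> :: "'a mat set \<Rightarrow> 'a mat \<Rightarrow> complex"
    and \<gamma> :: "'a mat set \<Rightarrow> 'a mat"
  assumes "g \<in> carrier (GL n)"
    and "H_irreducibles n \<Lambda> dH \<rho>H"
    and "flag_bimodule_decomposition n \<Lambda> dG \<rho>G dH \<rho>H"
    and "geck_rouquier_basis n \<kappa>"
    and "\<forall>\<nu>\<in>weyl_classes n. \<gamma> \<nu> \<in> min_length_elements n \<nu>"
  shows
    "(\<forall>w\<in>weyl_group n.
        of_nat (card (lusztig_variety n w (inv\<^bsub>GL n\<^esub> g))) = flag_trace n g (hecke_T n w) \<and>
        flag_trace n g (hecke_T n w) =
          of_nat (card (flags n :: 'a mat set set)) / of_nat (card (GL_class n g))
            * of_nat (card (GL_class n g \<inter> double_coset n (inv\<^bsub>GL n\<^esub> w))) \<and>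
        flag_trace n g (hecke_T n w) =
          (\<Sum>l\<in>\<Lambda>. mat_trace (\<rho>G l g) * mat_trace (\<rho>H l (hecke_T n w)))) \<and>
     A_elem n g \<in> center_of n (hecke_algebra n) \<and>
     A_elem n g = (\<Sum>\<nu>\<in>weyl_classes n. cscale (flag_trace n g (hecke_T n (\<gamma> \<nu>))) (\<kappa> \<nu>)) \<and>
     A_elem n g =
       cscale (of_nat (card (flags n :: 'a mat set set)))
         (\<Sum>l\<in>\<Lambda>. cscale (mat_trace (\<rho>G l g) / mat_trace (\<rho>G l (1\<^sub>m n)))
                   (central_idempotent n (\<rho>G l) (\<rho>H l))) \<and>
     scaled_class_sum n g \<in> center_of n (group_algebra n) \<and>
     (\<forall>v\<in>flag_rep n. galg_mult n v (A_elem n g) = galg_mult n (scaled_class_sum n g) v)"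
proof -
  have fin: "finite \<Lambda>" using assms(2) by (simp add: H_irreducibles_def)
  have \<rho>H: "\<rho>H l (hecke_T n w) \<in> carrier_mat (dH l) (dH l)" if "l \<in> \<Lambda>" "w \<in> weyl_group n" for l w
  proof -
    have "H_module n (dH l) (\<rho>H l)"
      using assms(2) that(1) by (simp add: H_irreducibles_def irreducible_H_module_def)
    then show ?thesis
      using hecke_T_in_hecke_algebra[OF that(2)] unfolding H_module_def by blast
  qed
  have characters: "flag_trace n g (hecke_T n w) =
      (\<Sum>l\<in>\<Lambda>. mat_trace (\<rho>G l g) * mat_trace (\<rho>H l (hecke_T n w)))" if "w \<in> weyl_group n" for w
    using \<rho>H that
    by (intro flag_trace_eq_characters[OF assms(1) hecke_T_in_hecke_algebra fin assms(3)]) auto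
  have \<rho>G: "mat_trace (\<rho>G l (1\<^sub>m n)) \<noteq> 0" if "l \<in> \<Lambda>" for l
    using assms(3) that
    by (intro mat_trace_one_irreducible_G_module) (auto simp: flag_bimodule_decomposition_def)
  show ?thesis
  proof (intro conjI ballI)
    show "A_elem n g = (\<Sum>\<nu>\<in>weyl_classes n. cscale (flag_trace n g (hecke_T n (\<gamma> \<nu>))) (\<kappa> \<nu>))"
      using assms(5) by (intro A_elem_geck_rouquier[OF assms(1,4)]) simp
    show "galg_mult n v (A_elem n g) = galg_mult n (scaled_class_sum n g) v" if "v \<in> flag_rep n" for v
      using that by (intro galg_mult_A_elem_right[OF assms(1)]) (simp_all add: flag_rep_iff)
  qed (simp_all only: flag_trace_eq_lusztig[OF assms(1), symmetric] flag_trace_eq_class[OF assms(1), symmetric] characters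
      A_elem_central[OF assms(1)] scaled_class_sum_central[OF assms(1)]
      A_elem_central_idempotents[OF fin \<rho>G characters, symmetric])
qed

end
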